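(* For each $i\in\{1,6,7\}$, consider the combinatorics $\{i\}$ of ten lines described in the context; its automorphism group $\Aut(\{i\})$ has a subgroup isomorphic to $\mathbb{Z}_2$, and its moduli space $\mathcal{M}_{\{i\}}$ has two connected components. There are representatives $\{i\}^+$ and $\{i\}^-$ of the two components of $\mathcal{M}_{\{i\}}$ such that the map $\varphi:\mathbb{CP}^2\to\mathbb{CP}^2$, $[x:y:z]\mapsto[y:x:z]$, restricts to a homeomorphism between the complements $\mathbb{CP}^2\setminus\bigcup_{L\in\{i\}^+}L$ and $\mathbb{CP}^2\setminus\bigcup_{L\in\{i\}^-}L$.
   Context: A line arrangement $\mathcal{A}=\{L_1,\dots,L_n\}$ in $\mathbb{CP}^2$ is a finite collection of distinct labelled projective lines. Its intersection lattice is $\mathrm{Lat}(\mathcal{A})=\{\bigcap_{j\in S}L_j\mid S\subseteq\{1,\dots,n\}\}$, partially ordered by reverse inclusion. Two labelled arrangements $\mathcal{A},\mathcal{B}$ have identical lattices if $\bigcap_{j\in S}L_j\mapsto\bigcap_{j\in S}L'_j$ is a well-defined isomorphism of posets; equivalently, the same sets of indices correspond to concurrent lines. $\Aut(\mathcal{A})$ is the group of permutations $\tau$ of $\{1,\dots,n\}$ such that $\{L_{\tau(1)},\dots,L_{\tau(n)}\}$ and $\mathcal{A}$ have identical lattices. The (ordered) moduli space $\mathcal{M}_{\mathcal{A}}$ is the quotient by $PGL(3,\mathbb{C})$ of the set of $\mathcal{B}\in((\mathbb{CP}^2)^* )^n$ whose lattice is identical to that of $\mathcal{A}$, with the quotient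 of the subspace topology. The combinatorics are given by listing, for each point of multiplicity at least three, the set of indices of the lines through it; all other intersection points are double points. In each case the moduli space is known to consist of exactly two points. $\{1\}$ (10 lines): $\{1,2,3,10\}$, $\{4,5,6,10\}$, $\{7,8,10\}$, $\{3,4,9\}$, $\{5,7,9\}$, $\{2,6,7\}$, $\{2,8,9\}$, $\{3,6,8\}$, $\{1,5,8\}$, $\{1,4,7\}$. $\{6\}$ (10 lines): $\{1,2,3\}$, $\{1,4,7\}$, $\{1,6,9\}$, $\{2,4,8\}$, $\{2,5,7\}$, $\{3,5,9\}$, $\{3,6,8\}$, $\{4,5,6\}$, $\{7,8,9\}$, $\{4,9,10\}$, $\{3,7,10\}$, $\{1,5,10\}$. $\{7\}$ (10 lines): $\{1,2,3\}$, $\{1,4,7\}$, $\{1,6,9\}$, $\{2,4,8\}$, $\{2,5,7\}$, $\{3,5,9\}$, $\{3,6,8\}$, $\{4,5,6\}$, $\{7,8,9\}$, $\{3,4,10\}$, $\{6,7,10\}$, $\{2,9,10\}$. Here $\Aut(\{i\})$ and $\mathcal{M}_{\{i\}}$ denote the automorphism group and moduli space of any labelled arrangement with the combinatorics $\{i\}$. *)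

theory Defs
  imports
    "HOL-Analysis.Analysis"
    "HOL-Algebra.Elementary_Groups"
    "HOL-Algebra.Sym_Groups"
begin

section \<open>The complex projective plane\<close>

definition proportional :: "complex^3 \<Rightarrow> complex^3 \<Rightarrow> bool" where
  "proportional v w \<longleftrightarrow> v \<noteq> 0 \<and> w \<noteq> 0 \<and> (\<exists>c. c \<noteq> 0 \<and> w = c *s v)"

lemma part_equivp_proportional: "part_equivp proportional"
proof (rule part_equivpI)
  have "(axis 1 1 :: complex^3) \<noteq> 0" by (simp add: axis_eq_0_iff)
  then have "proportional (axis 1 1) (axis 1 1)"
    unfolding proportional_def by (intro conjI exI[of _ 1]) auto
  then show "\<exists>x. proportional x x" ..
  show "symp proportional"
  proof (rule sympI)
    fix v w assume "proportional v w"
    then obtain c where "v \<noteq> 0" "w \<noteq> 0" "c \<noteq> 0" "w = c *s v"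
      unfolding proportional_def by blast
    then show "proportional w v"
      unfolding proportional_def
      by (intro conjI exI[of _ "inverse c"]) (auto simp: vec_eq_iff)
  qed
  show "transp proportional"
  proof (rule transpI)
    fix u v w assume "proportional u v" "proportional v w"
    then obtain c d where "u \<noteq> 0" "w \<noteq> 0" "c \<noteq> 0" "d \<noteq> 0" "v = c *s u" "w = d *s v"
      unfolding proportional_def by blast
    then show "proportional u w"
      unfolding proportional_def
      by (intro conjI exI[of _ "d * c"]) (auto simp: vec_eq_iff)
  qed
qed

quotient_type cp2 = "complex^3" / partial: proportional
  morphisms rep_cp2 proj
  by (rule part_equivp_proportional)

lemma proj_eq_iff:
  "v \<noteq> 0 \<Longrightarrow> w \<noteq> 0 \<Longrightarrow> proj v = proj w \<longleftrightarrow> (\<exists>c. c \<noteq> 0 \<and> w = c *s v)"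
proof -
  assume vw: "v \<noteq> 0" "w \<noteq> 0"
  have r: "proportional u u" if "u \<noteq> 0" for u
    unfolding proportional_def using that by (intro conjI exI[of _ 1]) auto
  have "proportional v w \<longleftrightarrow> proj v = proj w"
    using Quotient_rel[OF Quotient_cp2, of v w] r vw by blast
  then show ?thesis using vw by (auto simp: proportional_def)
qed

lemma proj_surj: "\<exists>v. v \<noteq> 0 \<and> p = proj v"
proof -
  have "proportional (rep_cp2 p) (rep_cp2 p)" "proj (rep_cp2 p) = p"
    using Quotient_rep_reflp[OF Quotient_cp2] Quotient_abs_rep[OF Quotient_cp2] by auto
  then show ?thesis unfolding proportional_def by metis
qed

text \<open>The topology is the quotient topology along \<open>proj\<close> restricted to the nonzero vectors.\<close>

instantiation cp2 :: topological_space
begin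

definition open_cp2 :: "cp2 set \<Rightarrow> bool" where
  "open_cp2 U \<longleftrightarrow> open {v. v \<noteq> 0 \<and> proj v \<in> U}"

instance
proof
  have "{v::complex^3. v \<noteq> 0 \<and> proj v \<in> UNIV} = - {0}" by auto
  then show "open (UNIV :: cp2 set)" unfolding open_cp2_def by auto
next
  fix S T :: "cp2 set" assume "open S" "open T"
  moreover have "{v. v \<noteq> 0 \<and> proj v \<in> S \<inter> T} =
      {v. v \<noteq> 0 \<and> proj v \<in> S} \<inter> {v. v \<noteq> 0 \<and> proj v \<in> T}" by auto
  ultimately show "open (S \<inter> T)" unfolding open_cp2_def by auto
next
  fix K :: "cp2 set set" assume "\<forall>S\<in>K. open S"
  moreover have "{v. v \<noteq> 0 \<and> proj v \<in> \<Union>K} = (\<Union>S\<in>K. {v. v \<noteq> 0 \<and> proj v \<in> S})" by auto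
  ultimately show "open (\<Union>K)" unfolding open_cp2_def by auto
qed

end

definition PGL3 :: "(cp2 \<Rightarrow> cp2) set" where
  "PGL3 = {g. \<exists>M :: complex^3^3. invertible M \<and> (\<forall>v. v \<noteq> 0 \<longrightarrow> g (proj v) = proj (M *v v))}"

lemma ex_PGL3:
  assumes M: "invertible (M :: complex^3^3)"
  shows "\<exists>g\<in>PGL3. \<forall>v. v \<noteq> 0 \<longrightarrow> g (proj v) = proj (M *v v)"
proof -
  define g where "g p = proj (M *v (SOME v. v \<noteq> 0 \<and> p = proj v))" for p
  have nz: "M *v v \<noteq> 0" if "v \<noteq> 0" for v
    using M that by (metis invertible_def matrix_vector_mul_assoc matrix_vector_mul_lid
        matrix_vector_mult_0_right)
  have "g (proj v) = proj (M *v v)" if v: "v \<noteq> 0" for v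
  proof -
    let ?w = "SOME w. w \<noteq> 0 \<and> proj v = proj w"
    have w: "?w \<noteq> 0 \<and> proj v = proj ?w"
      by (rule someI[of _ v]) (use v in auto)
    then obtain c where "c \<noteq> 0" "?w = c *s v" using v by (meson proj_eq_iff)
    then have "M *v ?w = c *s (M *v v)" by (simp add: vector_scalar_commute)
    with \<open>c \<noteq> 0\<close> v w show ?thesis unfolding g_def using nz by (metis proj_eq_iff)
  qed
  then show ?thesis using M unfolding PGL3_def by blast
qed

text \<open>The map \<open>[x:y:z] \<mapsto> [y:x:z]\<close>.\<close>

lift_definition swap_xy :: "cp2 \<Rightarrow> cp2" is "\<lambda>v. vector [v $ 2, v $ 1, v $ 3]"
  unfolding proportional_def
  by (auto simp: vec_eq_iff forall_3)

lemma swap_xy_proj: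
  assumes "(x, y, z) \<noteq> (0, 0, 0)"
  shows "swap_xy (proj (vector [x, y, z])) = proj (vector [y, x, z])"
proof -
  have "proportional (vector [x, y, z]) (vector [x, y, z])"
    unfolding proportional_def using assms
    by (intro conjI exI[of _ 1]) (auto simp: vec_eq_iff forall_3)
  then show ?thesis by (subst swap_xy.abs_eq) auto
qed

section \<open>Lines and labelled arrangements\<close>

text \<open>
  The dual plane is again modelled by \<open>cp2\<close>, in dual coordinates: \<open>[a:b:c]\<close> represents the line
  \<open>a x + b y + c z = 0\<close>. The pairing is bilinear, without complex conjugation.
\<close>

type_synonym cp2_dual = cp2

lift_definition incident :: "cp2 \<Rightarrow> cp2_dual \<Rightarrow> bool"
  is "\<lambda>v l. (\<Sum>i\<in>UNIV. l $ i * v $ i) = 0"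
proof -
  fix v w l m assume "proportional v w" "proportional l m"
  then obtain c d where "c \<noteq> 0" "d \<noteq> 0" "w = c *s v" "m = d *s l"
    unfolding proportional_def by blast
  moreover from this have "(\<Sum>i\<in>UNIV. m $ i * w $ i) = d * c * (\<Sum>i\<in>UNIV. l $ i * v $ i)"
    by (simp add: sum_distrib_left mult_ac)
  ultimately show "((\<Sum>i\<in>UNIV. l $ i * v $ i) = 0) = ((\<Sum>i\<in>UNIV. m $ i * w $ i) = 0)"
    by simp
qed

definition line :: "cp2_dual \<Rightarrow> cp2 set" where
  "line l = {p. incident p l}"

lemma proj_in_line_iff:
  assumes "v \<noteq> 0" "l \<noteq> 0"
  shows "proj v \<in> line (proj l) \<longleftrightarrow> l $ 1 * v $ 1 + l $ 2 * v $ 2 + l $ 3 * v $ 3 = 0"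
proof -
  have "proportional u u" if "u \<noteq> 0" for u
    unfolding proportional_def using that by (intro conjI exI[of _ 1]) auto
  then show ?thesis using assms by (simp add: line_def incident.abs_eq sum_3)
qed

text \<open>
  Tuples in \<open>((CP\<^sup>2)\<^sup>*)\<^sup>n\<close> are extensional functions on \<open>{1..n}\<close>, as in the library's product topology.
\<close>

definition arrangement :: "nat \<Rightarrow> (nat \<Rightarrow> cp2_dual) \<Rightarrow> bool" where
  "arrangement n A \<longleftrightarrow> A \<in> {1..n} \<rightarrow>\<^sub>E UNIV \<and> inj_on A {1..n}"

definition complement :: "nat \<Rightarrow> (nat \<Rightarrow> cp2_dual) \<Rightarrow> cp2 set" where
  "complement n A = UNIV - (\<Union>j\<in>{1..n}. line (A j))"

section \<open>Intersection lattices and automorphisms\<close>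

text \<open>The empty intersection \<open>flat A {}\<close> is the whole plane.\<close>

definition flat :: "(nat \<Rightarrow> cp2_dual) \<Rightarrow> nat set \<Rightarrow> cp2 set" where
  "flat A S = (\<Inter>j\<in>S. line (A j))"

definition Lat :: "nat \<Rightarrow> (nat \<Rightarrow> cp2_dual) \<Rightarrow> cp2 set set" where
  "Lat n A = flat A ` Pow {1..n}"

definition identical_lattices :: "nat \<Rightarrow> (nat \<Rightarrow> cp2_dual) \<Rightarrow> (nat \<Rightarrow> cp2_dual) \<Rightarrow> bool" where
  "identical_lattices n A B \<longleftrightarrow>
     (\<exists>f. (\<forall>S \<subseteq> {1..n}. f (flat A S) = flat B S) \<and>
          bij_betw f (Lat n A) (Lat n B) \<and>
          (\<forall>X \<in> Lat n A. \<forall>Y \<in> Lat n A. X \<supseteq> Y \<longleftrightarrow> f X \<supseteq> f Y))"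

definition Aut :: "nat \<Rightarrow> (nat \<Rightarrow> cp2_dual) \<Rightarrow> (nat \<Rightarrow> nat) monoid" where
  "Aut n A = (sym_group n)
     \<lparr>carrier := {\<tau>. \<tau> permutes {1..n} \<and> identical_lattices n (A \<circ> \<tau>) A}\<rparr>"

lemma identical_lattices_iff:
  "identical_lattices n A B \<longleftrightarrow>
     (\<forall>S \<subseteq> {1..n}. \<forall>T \<subseteq> {1..n}. flat A S \<supseteq> flat A T \<longleftrightarrow> flat B S \<supseteq> flat B T)"
  (is "_ \<longleftrightarrow> ?R")
proof
  assume "identical_lattices n A B"
  then obtain f where "\<forall>S \<subseteq> {1..n}. f (flat A S) = flat B S"
    and "\<forall>X \<in> Lat n A. \<forall>Y \<in> Lat n A. X \<supseteq> Y \<longleftrightarrow> f X \<supseteq> f Y"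
    unfolding identical_lattices_def by (elim exE conjE)
  then have f: "\<And>S. S \<subseteq> {1..n} \<Longrightarrow> f (flat A S) = flat B S"
    and o: "\<And>X Y. X \<in> Lat n A \<Longrightarrow> Y \<in> Lat n A \<Longrightarrow> X \<supseteq> Y \<longleftrightarrow> f X \<supseteq> f Y"
    by simp_all
  show ?R
  proof (intro allI impI)
    fix S T assume S: "S \<subseteq> {1..n}" and T: "T \<subseteq> {1..n}"
    have "flat A S \<in> Lat n A" "flat A T \<in> Lat n A"
      unfolding Lat_def using S T by blast+
    from o[OF this] show "flat A S \<supseteq> flat A T \<longleftrightarrow> flat B S \<supseteq> flat B T"
      unfolding f[OF S] f[OF T] .
  qed
next
  assume R: ?R
  define f where "f X = flat B (SOME S. S \<subseteq> {1..n} \<and> flat A S = X)" for X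
  have f: "f (flat A S) = flat B S" if S: "S \<subseteq> {1..n}" for S
  proof -
    let ?T = "SOME T. T \<subseteq> {1..n} \<and> flat A T = flat A S"
    have "?T \<subseteq> {1..n} \<and> flat A ?T = flat A S"
      by (rule someI[of _ S]) (use S in auto)
    then have "?T \<subseteq> {1..n}" and eq: "flat A ?T = flat A S" by blast+
    with R S have "flat B ?T \<subseteq> flat B S" "flat B S \<subseteq> flat B ?T" by blast+
    then show ?thesis unfolding f_def by (rule subset_antisym)
  qed
  have "f ` Lat n A = Lat n B"
    unfolding Lat_def image_image by (rule image_cong) (use f in blast)+
  moreover have o: "\<forall>X \<in> Lat n A. \<forall>Y \<in> Lat n A. X \<supseteq> Y \<longleftrightarrow> f X \<supseteq> f Y"
  proof (intro ballI)
    fix X Y assume "X \<in> Lat n A" "Y \<in> Lat n A"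
    then obtain S T where S: "S \<subseteq> {1..n}" "X = flat A S" and T: "T \<subseteq> {1..n}" "Y = flat A T"
      unfolding Lat_def by blast
    show "X \<supseteq> Y \<longleftrightarrow> f X \<supseteq> f Y"
      unfolding S(2) T(2) f[OF S(1)] f[OF T(1)] using R S(1) T(1) by blast
  qed
  moreover have "inj_on f (Lat n A)"
  proof (rule inj_onI)
    fix X Y assume X: "X \<in> Lat n A" and Y: "Y \<in> Lat n A" and eq: "f X = f Y"
    from o X Y have "X \<supseteq> Y" "Y \<supseteq> X" using eq by blast+
    then show "X = Y" by (rule subset_antisym[rotated])
  qed
  ultimately show "identical_lattices n A B"
    unfolding identical_lattices_def bij_betw_def using f by blast
qed

lemma identical_lattices_permute:
  assumes "\<tau> permutes {1..n}" "identical_lattices n A B"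
  shows "identical_lattices n (A \<circ> \<tau>) (B \<circ> \<tau>)"
proof -
  have "flat (C \<circ> \<tau>) S = flat C (\<tau> ` S)" for C S by (auto simp: flat_def)
  moreover have "\<tau> ` S \<subseteq> {1..n}" if "S \<subseteq> {1..n}" for S
    using that permutes_image[OF assms(1)] by blast
  ultimately show ?thesis using assms(2) by (simp add: identical_lattices_iff)
qed

lemma identical_lattices_refl: "identical_lattices n A A"
  by (simp add: identical_lattices_iff)

lemma identical_lattices_trans:
  "identical_lattices n A B \<Longrightarrow> identical_lattices n B C \<Longrightarrow> identical_lattices n A C"
  by (simp add: identical_lattices_iff)

lemma identical_lattices_sym: "identical_lattices n A B \<Longrightarrow> identical_lattices n B A"
  by (simp add: identical_lattices_iff)

lemma group_Aut: "group (Aut n A)"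
proof -
  interpret G: group "sym_group n" by (rule sym_group_is_group)
  let ?H = "{\<tau>. \<tau> permutes {1..n} \<and> identical_lattices n (A \<circ> \<tau>) A}"
  have "subgroup ?H (sym_group n)"
  proof (rule G.subgroupI)
    show "?H \<subseteq> carrier (sym_group n)" unfolding sym_group_def by auto
    have "id \<in> ?H" using identical_lattices_refl[of n A] by (simp add: permutes_id)
    then show "?H \<noteq> {}" by blast
  next
    fix a assume a: "a \<in> ?H"
    then have p: "a permutes {1..n}" by simp
    from a have "identical_lattices n (A \<circ> a) A" by simp
    from identical_lattices_permute[OF permutes_inv[OF p] this]
    have "identical_lattices n A (A \<circ> inv' a)"
      unfolding comp_assoc permutes_inv_o(1)[OF p] comp_id .
    then have "identical_lattices n (A \<circ> inv' a) A"
      by (rule identical_lattices_sym)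
    moreover have "inv\<^bsub>sym_group n\<^esub> a = inv' a"
      using p by (intro sym_group_inv_equality) (simp add: sym_group_def)
    ultimately show "inv\<^bsub>sym_group n\<^esub> a \<in> ?H"
      using permutes_inv[OF p] by simp
  next
    fix a b assume a: "a \<in> ?H" and b: "b \<in> ?H"
    from a have a': "a permutes {1..n}" "identical_lattices n (A \<circ> a) A" by simp_all
    from b have b': "b permutes {1..n}" "identical_lattices n (A \<circ> b) A" by simp_all
    from identical_lattices_trans[OF identical_lattices_permute[OF b'(1) a'(2)] b'(2)]
    have "identical_lattices n (A \<circ> (a \<circ> b)) A" unfolding comp_assoc .
    moreover have "a \<circ> b permutes {1..n}" by (rule permutes_compose[OF b'(1) a'(1)])
    ultimately show "a \<otimes>\<^bsub>sym_group n\<^esub> b \<in> ?H"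
      unfolding sym_group_def by simp
  qed
  then show ?thesis unfolding Aut_def by (rule G.subgroup_imp_group)
qed

section \<open>Moduli spaces\<close>

definition quotient_topology :: "'a topology \<Rightarrow> ('a \<Rightarrow> 'b) \<Rightarrow> 'b topology" where
  "quotient_topology X q =
     topology (\<lambda>U. U \<subseteq> q ` topspace X \<and> openin X {x \<in> topspace X. q x \<in> U})"

lemma openin_quotient_topology:
  "openin (quotient_topology X q) U \<longleftrightarrow>
     U \<subseteq> q ` topspace X \<and> openin X {x \<in> topspace X. q x \<in> U}"
proof -
  have "istopology (\<lambda>U. U \<subseteq> q ` topspace X \<and> openin X {x \<in> topspace X. q x \<in> U})"
    unfolding istopology_def
  proof (rule conjI; intro allI impI)
    fix S T
    assume "S \<subseteq> q ` topspace X \<and> openin X {x \<in> topspace X. q x \<in> S}"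
      "T \<subseteq> q ` topspace X \<and> openin X {x \<in> topspace X. q x \<in> T}"
    moreover have "{x \<in> topspace X. q x \<in> S \<inter> T} =
        {x \<in> topspace X. q x \<in> S} \<inter> {x \<in> topspace X. q x \<in> T}" by auto
    ultimately show "S \<inter> T \<subseteq> q ` topspace X \<and> openin X {x \<in> topspace X. q x \<in> S \<inter> T}"
      by (auto intro: openin_Int)
  next
    fix K assume "\<forall>S\<in>K. S \<subseteq> q ` topspace X \<and> openin X {x \<in> topspace X. q x \<in> S}"
    moreover have "{x \<in> topspace X. q x \<in> \<Union>K} = (\<Union>S\<in>K. {x \<in> topspace X. q x \<in> S})" by auto
    ultimately show "\<Union>K \<subseteq> q ` topspace X \<and> openin X {x \<in> topspace X. q x \<in> \<Union>K}"
      by (auto intro!: openin_Union)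
  qed
  then show ?thesis unfolding quotient_topology_def by simp
qed

lemma topspace_quotient_topology: "topspace (quotient_topology X q) = q ` topspace X"
proof (rule antisym)
  show "topspace (quotient_topology X q) \<subseteq> q ` topspace X"
    using openin_quotient_topology by (metis openin_topspace)
  have "{x \<in> topspace X. q x \<in> q ` topspace X} = topspace X" by auto
  then show "q ` topspace X \<subseteq> topspace (quotient_topology X q)"
    by (intro openin_subset) (simp add: openin_quotient_topology)
qed

lemma quotient_map_quotient_topology: "quotient_map X (quotient_topology X q) q"
  unfolding quotient_map_def by (auto simp: topspace_quotient_topology openin_quotient_topology)

definition realizations :: "nat \<Rightarrow> (nat \<Rightarrow> cp2_dual) \<Rightarrow> (nat \<Rightarrow> cp2_dual) set" where
  "realizations n A = {B \<in> {1..n} \<rightarrow>\<^sub>E UNIV. identical_lattices n A B}"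

definition realization_space :: "nat \<Rightarrow> (nat \<Rightarrow> cp2_dual) \<Rightarrow> (nat \<Rightarrow> cp2_dual) topology" where
  "realization_space n A =
     subtopology (product_topology (\<lambda>_. euclidean) {1..n}) (realizations n A)"

text \<open>
  The orbit of an ordered tuple of lines; an element of \<open>PGL(3,C)\<close> acts on lines by taking images.
\<close>

definition PGL_orbit :: "nat \<Rightarrow> (nat \<Rightarrow> cp2_dual) \<Rightarrow> (nat \<Rightarrow> cp2_dual) set" where
  "PGL_orbit n B =
     {B' \<in> {1..n} \<rightarrow>\<^sub>E UNIV. \<exists>g \<in> PGL3. \<forall>j \<in> {1..n}. line (B' j) = g ` line (B j)}"

definition moduli_space :: "nat \<Rightarrow> (nat \<Rightarrow> cp2_dual) \<Rightarrow> (nat \<Rightarrow> cp2_dual) set topology" where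
  "moduli_space n A = quotient_topology (realization_space n A) (PGL_orbit n)"

section \<open>The combinatorics\<close>

definition has_combinatorics :: "nat \<Rightarrow> nat set set \<Rightarrow> (nat \<Rightarrow> cp2_dual) \<Rightarrow> bool" where
  "has_combinatorics n C A \<longleftrightarrow>
     {S. \<exists>p. S = {j \<in> {1..n}. p \<in> line (A j)} \<and> 3 \<le> card S} = C"

definition combinatorics :: "nat \<Rightarrow> nat set set" where
  "combinatorics i =
    (if i = 1 then
       {{1,2,3,10}, {4,5,6,10}, {7,8,10}, {3,4,9}, {5,7,9}, {2,6,7}, {2,8,9}, {3,6,8},
        {1,5,8}, {1,4,7}}
     else if i = 6 then
       {{1,2,3}, {1,4,7}, {1,6,9}, {2,4,8}, {2,5,7}, {3,5,9}, {3,6,8}, {4,5,6}, {7,8,9},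
        {4,9,10}, {3,7,10}, {1,5,10}}
     else if i = 7 then
       {{1,2,3}, {1,4,7}, {1,6,9}, {2,4,8}, {2,5,7}, {3,5,9}, {3,6,8}, {4,5,6}, {7,8,9},
        {3,4,10}, {6,7,10}, {2,9,10}}
     else undefined)"

end

theory Submission
  imports Defs
begin

text \<open>
  A realization is determined, up to a projective change of coordinates, by moving four of its lines
  to the standard frame. In each of the three cases one further line then carries a single parameter
  \<open>t\<close>, a cross ratio; the remaining lines are constructed by joining intersection points, and the
  concurrency conditions left over reduce to \<open>t\<^sup>2 = t + 1\<close>. Both roots give realizations, so the
  moduli space consists of two orbits, and it is discrete because the cross ratio separates them by
  an open condition. An involution of the combinatorics maps \<open>t\<close> to \<open>1 - t\<close>: relabelling a
  realization by it leads to the other orbit without changing the union of the lines, and applying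
  the projective map \<open>[x:y:z] \<mapsto> [y:x:z]\<close> does not change the orbit.
\<close>

section \<open>Vectors, brackets and lines\<close>

text \<open>Multiple points and lattices quantify over all points and flats. Both are traded for the
  vanishing of a 3 x 3 determinant of dual coordinates on triples of distinct labels: this data
  fixes the lattice, is polynomial, and is projectively invariant. Two obstacles shape the rest. The
  representatives \<open>rep_cp2\<close> are an unspecified choice with no continuity available, so
  every condition has to be homogeneous, and openness is proved for vectors and pushed down along
  \<open>proj\<close>. Moreover the parameter \<open>t\<close> must still make sense after a
  relabelling, when the four frame lines no longer have standard coordinates; hence it is expressed
  by determinants. The two roots are never computed apart: calculations take place among the numbers
  m + n t, where t -> 1 - t is the nontrivial conjugation, so that one finite check serves both. The
  swap of coordinates has no special relation to the three combinatorics. A pair of representatives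
  is obtained from an arbitrary realization and the swapped image of its relabelling, so no
  coordinates adapted to the swap are required.\<close>

definition bracket :: "complex^3 \<Rightarrow> complex^3 \<Rightarrow> complex^3 \<Rightarrow> complex" where
  "bracket u v w = u$1 * (v$2 * w$3 - v$3 * w$2) - u$2 * (v$1 * w$3 - v$3 * w$1)
     + u$3 * (v$1 * w$2 - v$2 * w$1)"

definition cross :: "complex^3 \<Rightarrow> complex^3 \<Rightarrow> complex^3" where
  "cross u v = vector [u$2 * v$3 - u$3 * v$2, u$3 * v$1 - u$1 * v$3, u$1 * v$2 - u$2 * v$1]"

definition pairing :: "complex^3 \<Rightarrow> complex^3 \<Rightarrow> complex" where
  "pairing l v = l$1 * v$1 + l$2 * v$2 + l$3 * v$3"

lemma bracket_scale:
  "bracket (a *s u) (b *s v) (c *s w) = a * b * c * bracket u v w"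
  by (simp add: bracket_def algebra_simps)

lemma bracket_eq_det: "bracket u v w = det (vector [u, v, w])"
  by (simp add: bracket_def det_3 algebra_simps)

lemma bracket_mult: "bracket (M *v u) (M *v v) (M *v w) = det M * bracket u v w"
proof -
  have "(vector [M *v u, M *v v, M *v w] :: complex^3^3) $ i = (vector [u, v, w] ** transpose M) $ i" for i
    using exhaust_3[of i]
    by (auto simp: vec_eq_iff matrix_matrix_mult_def matrix_vector_mult_def transpose_def mult.commute)
  then have "(vector [M *v u, M *v v, M *v w] :: complex^3^3) = vector [u, v, w] ** transpose M"
    unfolding vec_eq_iff by blast
  then show ?thesis by (simp add: bracket_eq_det det_mul mult.commute)
qed

lemma bracket_permute:
  "bracket v u w = - bracket u v w" "bracket u w v = - bracket u v w"
  by (simp_all add: bracket_def algebra_simps)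

lemma bracket_rotate: "bracket u v w = bracket v w u"
  by (simp add: bracket_def algebra_simps)

lemma pairing_cross: "pairing u (cross v w) = bracket u v w"
  by (simp add: pairing_def cross_def bracket_def algebra_simps)

text \<open>The coordinates of the cross product are the 2 x 2 minors of the pair; if all vanish,
  any nonzero coordinate of \<open>u\<close> yields the factor.\<close>

lemma cross_eq_0:
  assumes "u \<noteq> 0" "v \<noteq> 0" "cross u v = 0"
  shows "\<exists>c. c \<noteq> 0 \<and> v = c *s u"
proof -
  have e: "u$2 * v$3 = u$3 * v$2" "u$3 * v$1 = u$1 * v$3" "u$1 * v$2 = u$2 * v$1"
    using assms(3) by (simp_all add: cross_def vec_eq_iff forall_3)
  have "\<exists>i. u $ i \<noteq> 0" using assms(1) by (simp add: vec_eq_iff)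
  then obtain i where i: "u $ i \<noteq> 0" ..
  have p: "u $ i * v $ j = u $ j * v $ i" for j
    using exhaust_3[of i] exhaust_3[of j] e by auto
  have v: "v = (v $ i / u $ i) *s u"
  proof -
    have "v $ j = v $ i / u $ i * u $ j" for j
      using i p[of j] by (simp add: nonzero_divide_eq_eq mult.commute eq_divide_eq)
    then show ?thesis unfolding vec_eq_iff vector_smult_component by blast
  qed
  moreover have "v $ i / u $ i \<noteq> 0"
    using v assms(2) by (metis vector_smult_lzero)
  ultimately show ?thesis by blast
qed

text \<open>Cramer's rule with the denominator cleared, so that it is a polynomial identity valid
  for dependent triples too.\<close>

lemma cramer_bracket:
  "bracket a b c *s v = bracket v b c *s a + bracket a v c *s b + bracket a b v *s c"
  by (simp add: vec_eq_iff forall_3 bracket_def algebra_simps)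

text \<open>Read dually: \<open>v\<close> and \<open>w\<close> are lines through the points where
  \<open>a\<close> meets \<open>b\<close> and where \<open>c\<close> meets \<open>d\<close>. The two
  determinants keep these points distinct, so their joining line is unique. The vector
  \<open>m\<close> is that line, the combination of \<open>a\<close> and \<open>b\<close> that also
  lies in the span of \<open>c\<close> and \<open>d\<close>.\<close>

lemma meet_unique:
  assumes abc: "bracket a b c \<noteq> 0" and acd: "bracket a c d \<noteq> 0"
    and v: "v \<noteq> 0" "bracket a b v = 0" "bracket c d v = 0"
    and w: "w \<noteq> 0" "bracket a b w = 0" "bracket c d w = 0"
  shows "\<exists>k. k \<noteq> 0 \<and> v = k *s w"
proof -
  define m where "m = bracket a c d *s b - bracket b c d *s a"
  have *: "\<exists>k. k \<noteq> 0 \<and> x = k *s m" if x: "x \<noteq> 0" "bracket a b x = 0" "bracket c d x = 0" for x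
  proof -
    have 1: "bracket a b c *s x = bracket x b c *s a + bracket a x c *s b"
      using cramer_bracket[of a b c x] x(2) by simp
    \<comment> \<open>The Cramer expansion of \<open>x\<close>, paired with \<open>c\<close> and
      \<open>d\<close>.\<close>
    have "bracket a b c * bracket c d x = bracket x b c * bracket a c d + bracket a x c * bracket b c d
            + bracket a b x * bracket c c d"
      by (simp add: bracket_def algebra_simps)
    then have 2: "bracket x b c * bracket a c d = - (bracket a x c * bracket b c d)"
      using x(2,3) by (simp add: add_eq_0_iff)
    have "(bracket a b c * bracket a c d) *s x = bracket a c d *s (bracket a b c *s x)"
      by (simp add: mult.commute)
    also have "\<dots> = (bracket x b c * bracket a c d) *s a + (bracket a x c * bracket a c d) *s b"
      unfolding 1 by (simp add: vec_eq_iff algebra_simps)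
    also have "\<dots> = bracket a x c *s m"
      unfolding 2 m_def by (simp add: vec_eq_iff algebra_simps)
    finally have 3: "(bracket a b c * bracket a c d) *s x = bracket a x c *s m" .
    have x': "x = (bracket a x c / (bracket a b c * bracket a c d)) *s m"
      using arg_cong[OF 3, of "\<lambda>y. inverse (bracket a b c * bracket a c d) *s y"] abc acd
      unfolding vector_smult_assoc divide_inverse
      by (metis left_inverse mult.commute mult_eq_0_iff vector_smult_lid)
    moreover have "bracket a x c / (bracket a b c * bracket a c d) \<noteq> 0"
      using x' x(1) by (metis vector_smult_lzero)
    ultimately show ?thesis by blast
  qed
  obtain k where k: "k \<noteq> 0" "v = k *s m" using *[OF v] by blast
  obtain k' where k': "k' \<noteq> 0" "w = k' *s m" using *[OF w] by blast
  have "v = (k / k') *s w" using k k' by simp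
  then show ?thesis using k k' by (metis divide_eq_0_iff)
qed

section \<open>Points and lines of the plane through representing vectors\<close>

lemma rep_cp2_nonzero [simp]: "rep_cp2 l \<noteq> 0"
  using Quotient_rep_reflp[OF Quotient_cp2] by (auto simp: proportional_def)

lemma proj_rep_cp2 [simp]: "proj (rep_cp2 l) = l"
  using Quotient_abs_rep[OF Quotient_cp2] .

lemma rep_cp2_proj: "v \<noteq> 0 \<Longrightarrow> \<exists>c. c \<noteq> 0 \<and> rep_cp2 (proj v) = c *s v"
  by (metis proj_eq_iff proj_rep_cp2 rep_cp2_nonzero)

lemma proj_scale: "c \<noteq> 0 \<Longrightarrow> v \<noteq> 0 \<Longrightarrow> proj (c *s v) = proj v"
  by (metis proj_eq_iff vector_mul_eq_0)

lemma proj_in_line: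
  "v \<noteq> 0 \<Longrightarrow> l \<noteq> 0 \<Longrightarrow> proj v \<in> line (proj l) \<longleftrightarrow> pairing l v = 0"
  by (simp add: proj_in_line_iff pairing_def)

lemma bracket_eq_0_trivial [simp]:
  "bracket u u v = 0" "bracket u v u = 0" "bracket v u u = 0"
  by (simp_all add: bracket_def algebra_simps)

text \<open>Tested on the chosen representatives; \<open>concurrent_proj\<close> shows that any
  others would do. Triples with a repeated line count as concurrent.\<close>

definition concurrent :: "cp2 \<Rightarrow> cp2 \<Rightarrow> cp2 \<Rightarrow> bool" where
  "concurrent a b c \<longleftrightarrow> bracket (rep_cp2 a) (rep_cp2 b) (rep_cp2 c) = 0"

lemma concurrent_proj:
  assumes "u \<noteq> 0" "v \<noteq> 0" "w \<noteq> 0"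
  shows "concurrent (proj u) (proj v) (proj w) \<longleftrightarrow> bracket u v w = 0"
proof -
  obtain a b c where "a \<noteq> 0" "rep_cp2 (proj u) = a *s u" "b \<noteq> 0" "rep_cp2 (proj v) = b *s v"
    "c \<noteq> 0" "rep_cp2 (proj w) = c *s w"
    using rep_cp2_proj assms by metis
  then show ?thesis by (simp add: concurrent_def bracket_scale)
qed

lemma concurrent_permute:
  "concurrent b a c \<longleftrightarrow> concurrent a b c" "concurrent a c b \<longleftrightarrow> concurrent a b c"
  unfolding concurrent_def by (metis bracket_permute neg_equal_0_iff_equal)+

lemma concurrent_trivial [simp]: "concurrent a a b" "concurrent a b a" "concurrent b a a"
  by (simp_all add: concurrent_def)

text \<open>The cross product of two dual vectors represents their common point, and pairing it with
  a third one gives the determinant.\<close>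

lemma meet_of_lines:
  assumes "a \<noteq> b"
  obtains p where "line a \<inter> line b = {p}" "\<And>c. p \<in> line c \<longleftrightarrow> concurrent a b c"
proof -
  define u v where uv: "u = rep_cp2 a" "v = rep_cp2 b"
  have nz: "u \<noteq> 0" "v \<noteq> 0" and ab: "a = proj u" "b = proj v" by (simp_all add: uv)
  have x: "cross u v \<noteq> 0"
    using cross_eq_0[OF nz] assms ab nz proj_scale by metis
  have on: "proj (cross u v) \<in> line c \<longleftrightarrow> concurrent a b c" for c
  proof -
    have "proj (cross u v) \<in> line (proj (rep_cp2 c)) \<longleftrightarrow> pairing (rep_cp2 c) (cross u v) = 0"
      by (rule proj_in_line) (use x in auto)
    then show ?thesis
      using bracket_rotate[of "rep_cp2 c" "rep_cp2 a" "rep_cp2 b"] by (simp add: pairing_cross concurrent_def uv)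
  qed
  have "q = proj (cross u v)" if "q \<in> line a" "q \<in> line b" for q
  proof -
    obtain y where y: "y \<noteq> 0" "q = proj y" using proj_surj by metis
    have 0: "pairing u y = 0" "pairing v y = 0"
      using that proj_in_line y nz ab by blast+
    \<comment> \<open>The expansion of the double cross product: its coefficients are the two
      pairings, so a common point \<open>y\<close> must be proportional to
      \<open>cross u v\<close>.\<close>
    have "cross y (cross u v) = pairing v y *s u - pairing u y *s v"
      by (simp add: cross_def pairing_def vec_eq_iff forall_3 algebra_simps)
    then have "cross y (cross u v) = 0" by (simp add: 0)
    from cross_eq_0[OF y(1) x this] show ?thesis using y proj_scale by metis
  qed
  moreover have "proj (cross u v) \<in> line a" "proj (cross u v) \<in> line b"
    using on by simp_all
  ultimately have "line a \<inter> line b = {proj (cross u v)}" by blast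
  then show ?thesis using that on by blast
qed

lemma ex_line_avoiding: "\<exists>l. p \<notin> line l"
proof -
  obtain v where v: "v \<noteq> 0" "p = proj v" using proj_surj by metis
  have "\<exists>i. v $ i \<noteq> 0" using v(1) by (simp add: vec_eq_iff)
  then obtain i where i: "v $ i \<noteq> 0" ..
  have a: "(axis i 1 :: complex^3) \<noteq> 0" by (simp add: axis_eq_0_iff)
  have "pairing (axis i 1) v \<noteq> 0"
    using i exhaust_3[of i] by (auto simp: pairing_def axis_def)
  then show ?thesis using proj_in_line v a by blast
qed

text \<open>A line contained in a different line would be a single point, but a line avoiding this
  point still has to meet it.\<close>

lemma line_subset_iff: "line a \<subseteq> line b \<longleftrightarrow> a = b"
proof
  assume s: "line a \<subseteq> line b"
  show "a = b"
  proof (rule ccontr)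
    assume ab: "a \<noteq> b"
    obtain p where "line a \<inter> line b = {p}" by (rule meet_of_lines[OF ab])
    then have a: "line a = {p}" using s by blast
    obtain c where c: "p \<notin> line c" using ex_line_avoiding by blast
    then have ca: "c \<noteq> a" using a by auto
    obtain q where "line c \<inter> line a = {q}" by (rule meet_of_lines[OF ca])
    then show False using a c by auto
  qed
qed simp

lemma line_inject: "line a = line b \<longleftrightarrow> a = b"
  using line_subset_iff by blast

section \<open>Realizations of a combinatorics\<close>

definition concurrent_triple :: "nat set set \<Rightarrow> nat \<Rightarrow> nat \<Rightarrow> nat \<Rightarrow> bool" where
  "concurrent_triple C i j k \<longleftrightarrow> (\<exists>X\<in>C. {i, j, k} \<subseteq> X)"

text \<open>Turns the condition on multiple points into equations and inequations for triples of
  lines. Only distinct labels are compared, because repeated ones are always concurrent while they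
  need not share a block.\<close>

definition realizes :: "nat \<Rightarrow> nat set set \<Rightarrow> (nat \<Rightarrow> cp2_dual) \<Rightarrow> bool" where
  "realizes n C A \<longleftrightarrow> arrangement n A \<and>
     (\<forall>i\<in>{1..n}. \<forall>j\<in>{1..n}. \<forall>k\<in>{1..n}. i \<noteq> j \<longrightarrow> i \<noteq> k \<longrightarrow> j \<noteq> k \<longrightarrow>
       concurrent (A i) (A j) (A k) = concurrent_triple C i j k)"

lemma realizes_concurrent:
  "realizes n C A \<Longrightarrow> i \<in> {1..n} \<Longrightarrow> j \<in> {1..n} \<Longrightarrow> k \<in> {1..n} \<Longrightarrow>
     i \<noteq> j \<Longrightarrow> i \<noteq> k \<Longrightarrow> j \<noteq> k \<Longrightarrow>
     concurrent (A i) (A j) (A k) \<longleftrightarrow> concurrent_triple C i j k"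
  by (simp add: realizes_def)

lemma arrangement_distinct:
  "arrangement n A \<Longrightarrow> i \<in> {1..n} \<Longrightarrow> j \<in> {1..n} \<Longrightarrow> A i = A j \<longleftrightarrow> i = j"
  by (auto simp: arrangement_def inj_on_eq_iff simp del: atLeastAtMost_iff)

lemma realizes_distinct:
  "realizes n C A \<Longrightarrow> i \<in> {1..n} \<Longrightarrow> j \<in> {1..n} \<Longrightarrow> A i = A j \<longleftrightarrow> i = j"
  unfolding realizes_def using arrangement_distinct by blast

text \<open>All lines through the meet of two given ones form one set; as soon as it has a third
  member it is a block.\<close>

lemma has_combinatorics_imp_realizes:
  assumes A: "arrangement n A" and C: "has_combinatorics n C A"
  shows "realizes n C A"
  unfolding realizes_def
proof (intro conjI A ballI impI)
  fix i j k assume ijk: "i \<in> {1..n}" "j \<in> {1..n}" "k \<in> {1..n}" "i \<noteq> j" "i \<noteq> k" "j \<noteq> k"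
  have "A i \<noteq> A j" using arrangement_distinct[OF A ijk(1,2)] ijk(4) by simp
  from meet_of_lines[OF this] obtain p where p: "line (A i) \<inter> line (A j) = {p}"
    "\<And>c. p \<in> line c \<longleftrightarrow> concurrent (A i) (A j) c" by blast
  show "concurrent (A i) (A j) (A k) = concurrent_triple C i j k"
  proof
    assume c: "concurrent (A i) (A j) (A k)"
    define S where "S = {l \<in> {1..n}. p \<in> line (A l)}"
    have S: "{i, j, k} \<subseteq> S" using ijk p c by (auto simp: S_def)
    have "finite S" by (simp add: S_def)
    from card_mono[OF this S] have "3 \<le> card S" using ijk by simp
    then have "S \<in> C" using C unfolding has_combinatorics_def S_def by blast
    then show "concurrent_triple C i j k" using S by (auto simp: concurrent_triple_def)
  next
    assume "concurrent_triple C i j k"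
    then obtain X where X: "X \<in> C" "{i, j, k} \<subseteq> X" by (auto simp: concurrent_triple_def)
    then obtain q where "X = {l \<in> {1..n}. q \<in> line (A l)}"
      using C unfolding has_combinatorics_def by blast
    then have q: "q \<in> line (A i) \<inter> line (A j)" "q \<in> line (A k)" using X(2) by auto
    then have "q = p" using p(1) by simp
    then show "concurrent (A i) (A j) (A k)" using p(2)[of "A k"] q(2) by simp
  qed
qed

text \<open>The converse needs \<open>linear\<close>: blocks with two labels in common would belong
  to the same point and merge there.\<close>

lemma realizes_imp_has_combinatorics:
  assumes R: "realizes n C A"
    and blocks: "\<And>X. X \<in> C \<Longrightarrow> X \<subseteq> {1..n} \<and> 3 \<le> card X"
    and linear: "\<And>X Y i j. X \<in> C \<Longrightarrow> Y \<in> C \<Longrightarrow> i \<in> X \<inter> Y \<Longrightarrow> j \<in> X \<inter> Y \<Longrightarrow> i \<noteq> j \<Longrightarrow> X = Y"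
  shows "has_combinatorics n C A"
proof -
  have A: "arrangement n A" using R by (simp add: realizes_def)
  \<comment> \<open>Two shared labels \<open>i\<close>, \<open>j\<close> make \<open>p\<close> the
    meet of these lines. A further line passes through \<open>p\<close> iff some block contains it
    together with \<open>i\<close> and \<open>j\<close>, and by \<open>linear\<close> this block can
    only be \<open>X\<close>.\<close>
  have key: "S = X"
    if S: "S = {l \<in> {1..n}. p \<in> line (A l)}" and X: "X \<in> C" "i \<in> S \<inter> X" "j \<in> S \<inter> X" "i \<noteq> j" for S X p i j
  proof -
    have ij: "i \<in> {1..n}" "j \<in> {1..n}" using S X(2,3) by auto
    have "A i \<noteq> A j" using arrangement_distinct[OF A ij] X(4) by simp
    from meet_of_lines[OF this] obtain q where q: "line (A i) \<inter> line (A j) = {q}"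
      "\<And>c. q \<in> line c \<longleftrightarrow> concurrent (A i) (A j) c" by blast
    have "p \<in> line (A i) \<inter> line (A j)" using S X(2,3) by simp
    then have "p = q" using q(1) by simp
    then have on: "l \<in> S \<longleftrightarrow> concurrent (A i) (A j) (A l)" if "l \<in> {1..n}" for l
      using q(2) S that by simp
    have "l \<in> S \<longleftrightarrow> l \<in> X" if l: "l \<in> {1..n}" for l
    proof (cases "l = i \<or> l = j")
      case True then show ?thesis using X by auto
    next
      case False
      then have "l \<in> S \<longleftrightarrow> concurrent_triple C i j l"
        using on[OF l] realizes_concurrent[OF R ij l] X(4) by auto
      also have "\<dots> \<longleftrightarrow> l \<in> X"
      proof
        assume "concurrent_triple C i j l"
        then obtain Y where Y: "Y \<in> C" "{i, j, l} \<subseteq> Y" by (auto simp: concurrent_triple_def)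
        then have "X = Y" using linear[OF X(1) Y(1), of i j] X by blast
        then show "l \<in> X" using Y by blast
      qed (use X in \<open>auto simp: concurrent_triple_def\<close>)
      finally show ?thesis .
    qed
    moreover have "S \<subseteq> {1..n}" "X \<subseteq> {1..n}" using S blocks[OF X(1)] by auto
    ultimately show ?thesis by blast
  qed
  have pick: "\<exists>i j k. i \<in> X \<and> j \<in> X \<and> k \<in> X \<and> i \<noteq> j \<and> i \<noteq> k \<and> j \<noteq> k"
    if "3 \<le> card X" for X :: "nat set"
    using that by (auto simp: numeral_3_eq_3 card_le_Suc_iff)
  show ?thesis
    unfolding has_combinatorics_def
  proof (intro equalityI subsetI)
    fix S assume "S \<in> {S. \<exists>p. S = {j \<in> {1..n}. p \<in> line (A j)} \<and> 3 \<le> card S}"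
    then obtain p where S: "S = {j \<in> {1..n}. p \<in> line (A j)}" "3 \<le> card S" by blast
    then obtain i j k where ijk: "i \<in> S" "j \<in> S" "k \<in> S" "i \<noteq> j" "i \<noteq> k" "j \<noteq> k"
      using pick by blast
    have r: "i \<in> {1..n}" "j \<in> {1..n}" "k \<in> {1..n}" using ijk S by auto
    have "A i \<noteq> A j" using arrangement_distinct[OF A r(1,2)] ijk(4) by simp
    from meet_of_lines[OF this] obtain q where q: "line (A i) \<inter> line (A j) = {q}"
      "\<And>c. q \<in> line c \<longleftrightarrow> concurrent (A i) (A j) c" by blast
    have "p \<in> line (A i) \<inter> line (A j)" "p \<in> line (A k)" using ijk S(1) by simp_all
    then have "concurrent (A i) (A j) (A k)" using q(1) q(2)[of "A k"] by simp
    then obtain X where "X \<in> C" "{i, j, k} \<subseteq> X"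
      using realizes_concurrent[OF R r ijk(4-6)] by (auto simp: concurrent_triple_def)
    with key[OF S(1) this(1), of i j] show "S \<in> C" using ijk by auto
  next
    fix X assume X: "X \<in> C"
    then obtain i j where ij: "i \<in> X" "j \<in> X" "i \<noteq> j" using pick blocks by blast
    have r: "i \<in> {1..n}" "j \<in> {1..n}" using blocks[OF X] ij by blast+
    have "A i \<noteq> A j" using arrangement_distinct[OF A r] ij(3) by simp
    from meet_of_lines[OF this] obtain q where q: "line (A i) \<inter> line (A j) = {q}"
      "\<And>c. q \<in> line c \<longleftrightarrow> concurrent (A i) (A j) c" by blast
    have "{l \<in> {1..n}. q \<in> line (A l)} = X"
    proof (rule key[OF refl X, of i _ j])
      have "q \<in> line (A i)" "q \<in> line (A j)" using q(1) by blast+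
      then show "i \<in> {l \<in> {1..n}. q \<in> line (A l)} \<inter> X" "j \<in> {l \<in> {1..n}. q \<in> line (A l)} \<inter> X"
        using r ij by simp_all
    qed (rule ij(3))
    then show "X \<in> {S. \<exists>p. S = {j \<in> {1..n}. p \<in> line (A j)} \<and> 3 \<le> card S}"
      using blocks[OF X] by blast
  qed
qed

text \<open>A flat of at least two lines is either the meet of \<open>a\<close> and \<open>b\<close>
  or empty. It is empty when some line of \<open>T\<close> misses the meet, and then it lies in
  every line. Hence the inclusion is decided by \<open>C\<close> alone.\<close>

lemma flat_subset_line_iff:
  assumes R: "realizes n C A" and T: "T \<subseteq> {1..n}" "a \<in> T" "b \<in> T" "a \<noteq> b" and j: "j \<in> {1..n}"
  shows "flat A T \<subseteq> line (A j) \<longleftrightarrow>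
    (\<exists>c \<in> T - {a, b}. \<not> concurrent_triple C a b c) \<or> j \<in> {a, b} \<or> concurrent_triple C a b j"
proof -
  have ab: "a \<in> {1..n}" "b \<in> {1..n}" using T by auto
  have "A a \<noteq> A b" using arrangement_distinct[OF _ ab] R T(4) by (simp add: realizes_def)
  from meet_of_lines[OF this] obtain p where p: "line (A a) \<inter> line (A b) = {p}"
    "\<And>c. p \<in> line c \<longleftrightarrow> concurrent (A a) (A b) c" by blast
  have on: "p \<in> line (A c) \<longleftrightarrow> c \<in> {a, b} \<or> concurrent_triple C a b c" if c: "c \<in> {1..n}" for c
  proof (cases "c = a \<or> c = b")
    case True
    then show ?thesis using p(1) by blast
  next
    case False
    then show ?thesis using p(2)[of "A c"] realizes_concurrent[OF R ab c T(4)] by simp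
  qed
  have "flat A T \<subseteq> {p}" using p(1) T(2,3) by (auto simp: flat_def)
  then have "flat A T \<subseteq> line (A j) \<longleftrightarrow> p \<notin> flat A T \<or> p \<in> line (A j)" by blast
  moreover have "p \<in> flat A T \<longleftrightarrow> (\<forall>c \<in> T - {a, b}. concurrent_triple C a b c)"
    using on T(1) unfolding flat_def by blast
  ultimately show ?thesis using on[OF j] by blast
qed

lemma flat_subset_line_trivial:
  "\<not> flat A {} \<subseteq> line c" "flat A {a} \<subseteq> line c \<longleftrightarrow> A a = c"
proof -
  show "flat A {a} \<subseteq> line c \<longleftrightarrow> A a = c" by (simp add: flat_def line_subset_iff)
  show "\<not> flat A {} \<subseteq> line c"
  proof
    assume "flat A {} \<subseteq> line c"
    then have all: "p \<in> line c" for p by (auto simp: flat_def)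
    then have "line d \<subseteq> line c" for d by blast
    then have "d = c" for d by (simp only: line_subset_iff)
    then show False using all ex_line_avoiding by metis
  qed
qed

lemma flat_subset_iff: "flat A T \<subseteq> flat A S \<longleftrightarrow> (\<forall>j\<in>S. flat A T \<subseteq> line (A j))"
  by (auto simp: flat_def)

text \<open>The lattice is governed by the inclusions of flats in lines. For no line and for a
  single line these are trivial, and for two or more they depend only on \<open>C\<close>.\<close>

lemma realizes_imp_identical_lattices:
  assumes A: "realizes n C A" and B: "realizes n C B"
  shows "identical_lattices n A B"
proof -
  have "flat A T \<subseteq> line (A j) \<longleftrightarrow> flat B T \<subseteq> line (B j)"
    if T: "T \<subseteq> {1..n}" and j: "j \<in> {1..n}" for T j
  proof -
    consider "T = {}" | a where "T = {a}" | a b where "a \<in> T" "b \<in> T" "a \<noteq> b" by blast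
    then show ?thesis
    proof cases
      case 1 then show ?thesis by (simp add: flat_subset_line_trivial)
    next
      case 2
      then have "a \<in> {1..n}" using T by simp
      then have "A a = A j \<longleftrightarrow> a = j" "B a = B j \<longleftrightarrow> a = j"
        using realizes_distinct[OF A _ j] realizes_distinct[OF B _ j] by blast+
      then show ?thesis using 2 by (simp add: flat_subset_line_trivial)
    next
      case 3
      then show ?thesis
        using flat_subset_line_iff[OF A T 3 j] flat_subset_line_iff[OF B T 3 j] by blast
    qed
  qed
  then have "flat A T \<subseteq> flat A S \<longleftrightarrow> flat B T \<subseteq> flat B S"
    if "S \<subseteq> {1..n}" "T \<subseteq> {1..n}" for S T
    using that unfolding flat_subset_iff by blast
  then show ?thesis unfolding identical_lattices_iff by blast
qed

text \<open>Equality of two lines and concurrency of three are both inclusions of a flat in a line,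
  hence visible in the lattice. In particular a tuple with the same lattice automatically consists
  of distinct lines.\<close>

lemma identical_lattices_realizes:
  assumes A: "realizes n C A" and AB: "identical_lattices n A B" and B: "B \<in> {1..n} \<rightarrow>\<^sub>E UNIV"
  shows "realizes n C B"
proof -
  have sub: "flat A T \<subseteq> line (A j) \<longleftrightarrow> flat B T \<subseteq> line (B j)" if "T \<subseteq> {1..n}" "j \<in> {1..n}" for T j
  proof -
    have f: "line (D j) = flat D {j}" for D by (simp add: flat_def)
    show ?thesis
      using AB that unfolding identical_lattices_iff f by blast
  qed
  have "inj_on B {1..n}"
  proof (rule inj_onI)
    fix x y assume xy: "x \<in> {1..n}" "y \<in> {1..n}" "B x = B y"
    then have "A x = A y" using sub[of "{x}" y] by (simp add: flat_subset_line_trivial)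
    then show "x = y" using realizes_distinct[OF A xy(1,2)] by simp
  qed
  moreover have "concurrent (B i) (B j) (B k) = concurrent_triple C i j k"
    if ijk: "i \<in> {1..n}" "j \<in> {1..n}" "k \<in> {1..n}" "i \<noteq> j" "i \<noteq> k" "j \<noteq> k" for i j k
  proof -
    have *: "flat D {i, j} \<subseteq> line (D k) \<longleftrightarrow> concurrent (D i) (D j) (D k)" if D: "inj_on D {1..n}" for D
    proof -
      have ne: "D i \<noteq> D j" using inj_on_eq_iff[OF D] ijk by blast
      from meet_of_lines[OF ne] obtain p where "line (D i) \<inter> line (D j) = {p}"
        "\<And>c. p \<in> line c \<longleftrightarrow> concurrent (D i) (D j) c" by blast
      then show ?thesis by (simp add: flat_def)
    qed
    have "concurrent (B i) (B j) (B k) \<longleftrightarrow> concurrent (A i) (A j) (A k)"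
      using *[of A] *[of B] sub[of "{i, j}" k] ijk \<open>inj_on B {1..n}\<close> A
      by (simp add: realizes_def arrangement_def)
    then show ?thesis using realizes_concurrent[OF A ijk] by simp
  qed
  ultimately show ?thesis using B by (simp add: realizes_def arrangement_def)
qed

lemma realizations_eq:
  assumes "realizes n C A"
  shows "realizations n A = {B. realizes n C B}"
proof -
  have "B \<in> {1..n} \<rightarrow>\<^sub>E UNIV" if "realizes n C B" for B
    using that unfolding realizes_def arrangement_def by blast
  then show ?thesis
    unfolding realizations_def
    using identical_lattices_realizes[OF assms] realizes_imp_identical_lattices[OF assms] by blast
qed

section \<open>The projective action\<close>

definition act :: "complex^3^3 \<Rightarrow> cp2 \<Rightarrow> cp2" where
  "act M l = proj (M *v rep_cp2 l)"

lemma invertible_mult_nonzero: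
  assumes "invertible (M :: complex^3^3)" "v \<noteq> 0"
  shows "M *v v \<noteq> 0"
proof
  assume 0: "M *v v = 0"
  obtain N where "N ** M = mat 1" using assms(1) by (auto simp: invertible_def)
  then have "v = N *v (M *v v)" by (simp add: matrix_vector_mul_assoc)
  then show False using 0 assms(2) by simp
qed

lemma act_proj:
  assumes M: "invertible M" and v: "v \<noteq> 0"
  shows "act M (proj v) = proj (M *v v)"
proof -
  obtain c where c: "c \<noteq> 0" "rep_cp2 (proj v) = c *s v" using rep_cp2_proj[OF v] by blast
  have "M *v (c *s v) = c *s (M *v v)" by (simp add: vector_scalar_commute)
  then show ?thesis
    unfolding act_def c(2) using proj_scale[OF c(1) invertible_mult_nonzero[OF M v]] by simp
qed

lemma act_act:
  assumes "invertible M" "invertible N"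
  shows "act M (act N l) = act (M ** N) l"
proof -
  have "act M (act N l) = act M (proj (N *v rep_cp2 l))" by (simp add: act_def)
  also have "\<dots> = proj (M *v (N *v rep_cp2 l))"
    by (rule act_proj[OF assms(1)]) (simp add: invertible_mult_nonzero[OF assms(2)])
  finally show ?thesis by (simp add: act_def matrix_vector_mul_assoc)
qed

lemma act_mat_1 [simp]: "act (mat 1) l = l"
  by (simp add: act_def)

lemma invertible_inverse:
  assumes "invertible (M :: complex^3^3)"
  obtains N where "invertible N" "M ** N = mat 1" "N ** M = mat 1"
  using assms unfolding invertible_def by blast

lemma act_inject:
  assumes "invertible M"
  shows "act M a = act M b \<longleftrightarrow> a = b"
proof -
  obtain N where N: "invertible N" "N ** M = mat 1" using invertible_inverse[OF assms] by blast
  then have "act N (act M x) = x" for x by (simp add: act_act assms)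
  then show ?thesis by metis
qed

lemma concurrent_act:
  assumes M: "invertible M"
  shows "concurrent (act M a) (act M b) (act M c) \<longleftrightarrow> concurrent a b c"
proof -
  have "det M \<noteq> 0" using M by (simp add: invertible_det_nz)
  then show ?thesis
    unfolding act_def
    by (subst concurrent_proj) (auto simp: invertible_mult_nonzero[OF M] bracket_mult concurrent_def)
qed

lemma pairing_mult: "pairing (M *v l) w = pairing l (transpose M *v w)"
  by (simp add: pairing_def matrix_vector_mult_def transpose_def sum_3 algebra_simps)

text \<open>Points move by \<open>M\<close>, dual coordinates by the inverse transpose
  \<open>N\<close> of \<open>M\<close>: this preserves the pairing of lines with points.\<close>

lemma image_line:
  assumes g: "\<And>v. v \<noteq> 0 \<Longrightarrow> g (proj v) = proj (M *v v)"
    and M: "M ** transpose N = mat 1" "transpose N ** M = mat 1" and N: "invertible N"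
  shows "g ` line l = line (act N l)"
proof -
  have tN: "invertible (transpose N)" using M unfolding invertible_def by blast
  have *: "proj (M *v v) \<in> line (act N l) \<longleftrightarrow> proj v \<in> line l" if v: "v \<noteq> 0" for v
  proof -
    have "transpose N *v (M *v v) = v" by (simp add: matrix_vector_mul_assoc M)
    then have "pairing (N *v rep_cp2 l) (M *v v) = pairing (rep_cp2 l) v"
      by (simp add: pairing_mult)
    moreover have "M *v v \<noteq> 0"
      by (rule invertible_mult_nonzero[OF _ v]) (use M in \<open>auto simp: invertible_def\<close>)
    ultimately show ?thesis
      using proj_in_line[of "M *v v" "N *v rep_cp2 l"] proj_in_line[of v "rep_cp2 l"] v
      by (simp add: act_def invertible_mult_nonzero[OF N])
  qed
  show ?thesis
  proof (intro equalityI subsetI)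
    fix q assume "q \<in> g ` line l"
    then obtain p where p: "p \<in> line l" "q = g p" by blast
    obtain v where "v \<noteq> 0" "p = proj v" using proj_surj by metis
    then show "q \<in> line (act N l)" using * g p by simp
  next
    fix q assume q: "q \<in> line (act N l)"
    obtain w where w: "w \<noteq> 0" "q = proj w" using proj_surj by metis
    let ?v = "transpose N *v w"
    have v: "?v \<noteq> 0" by (rule invertible_mult_nonzero[OF tN w(1)])
    have Mv: "M *v ?v = w" by (metis M(1) matrix_vector_mul_assoc matrix_vector_mul_lid)
    have "g (proj ?v) = q" using g[OF v] Mv w by simp
    moreover have "proj ?v \<in> line l" using *[OF v] Mv q w by simp
    ultimately show "q \<in> g ` line l" by blast
  qed
qed

text \<open>Inverse transposition is a bijection of the invertible matrices, so orbits can be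
  described by matrices acting directly on dual coordinates.\<close>

lemma PGL_orbit_eq:
  "PGL_orbit n B =
    {B' \<in> {1..n} \<rightarrow>\<^sub>E UNIV. \<exists>M. invertible M \<and> (\<forall>j\<in>{1..n}. B' j = act M (B j))}"
proof -
  have dual: "\<exists>N. invertible N \<and> M ** transpose N = mat 1 \<and> transpose N ** M = mat 1"
    if M: "invertible M" for M :: "complex^3^3"
  proof -
    obtain K where K: "M ** K = mat 1" "K ** M = mat 1" using invertible_inverse[OF M] by blast
    have "transpose K ** transpose M = mat 1" "transpose M ** transpose K = mat 1"
      by (simp_all add: matrix_transpose_mul[symmetric] K transpose_mat)
    then have "invertible (transpose K)" unfolding invertible_def by blast
    then show ?thesis using K by (intro exI[of _ "transpose K"]) simp
  qed
  have "(\<exists>g \<in> PGL3. \<forall>j \<in> {1..n}. line (B' j) = g ` line (B j)) \<longleftrightarrow>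
      (\<exists>M. invertible M \<and> (\<forall>j\<in>{1..n}. B' j = act M (B j)))" for B'
  proof
    assume "\<exists>g \<in> PGL3. \<forall>j \<in> {1..n}. line (B' j) = g ` line (B j)"
    then obtain g M where "invertible M" and g: "\<And>v. v \<noteq> 0 \<Longrightarrow> g (proj v) = proj (M *v v)"
      and B': "\<And>j. j \<in> {1..n} \<Longrightarrow> line (B' j) = g ` line (B j)"
      unfolding PGL3_def by blast
    then obtain N where N: "M ** transpose N = mat 1" "transpose N ** M = mat 1" "invertible N"
      using dual by blast
    have "B' j = act N (B j)" if j: "j \<in> {1..n}" for j
      using B'[OF j] image_line[OF g N, of "B j"] line_inject[of "B' j"] by simp
    then show "\<exists>M. invertible M \<and> (\<forall>j\<in>{1..n}. B' j = act M (B j))" using N(3) by blast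
  next
    assume "\<exists>M. invertible M \<and> (\<forall>j\<in>{1..n}. B' j = act M (B j))"
    then obtain N where N: "invertible N" and B': "\<And>j. j \<in> {1..n} \<Longrightarrow> B' j = act N (B j)" by blast
    from dual[OF N] obtain M where M: "invertible M" "N ** transpose M = mat 1" "transpose M ** N = mat 1"
      by blast
    have M': "M ** transpose N = mat 1" "transpose N ** M = mat 1"
      using M(2,3) by (metis matrix_transpose_mul transpose_mat transpose_transpose)+
    obtain g where g: "g \<in> PGL3" "\<And>v. v \<noteq> 0 \<Longrightarrow> g (proj v) = proj (M *v v)"
      using ex_PGL3[OF M(1)] by blast
    have "line (B' j) = g ` line (B j)" if "j \<in> {1..n}" for j
      using image_line[OF g(2) M' N, of "B j"] B'[OF that] by simp
    then show "\<exists>g \<in> PGL3. \<forall>j \<in> {1..n}. line (B' j) = g ` line (B j)" using g(1) by blast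
  qed
  then show ?thesis unfolding PGL_orbit_def by blast
qed

lemma PGL_orbit_refl: "B \<in> {1..n} \<rightarrow>\<^sub>E UNIV \<Longrightarrow> B \<in> PGL_orbit n B"
  unfolding PGL_orbit_eq by (auto intro!: exI[of _ "mat 1"] simp: invertible_def)

lemma PGL_orbit_sym:
  assumes "B' \<in> PGL_orbit n B" "B \<in> {1..n} \<rightarrow>\<^sub>E UNIV"
  shows "B \<in> PGL_orbit n B'"
proof -
  obtain M where M: "invertible M" "\<And>j. j \<in> {1..n} \<Longrightarrow> B' j = act M (B j)"
    using assms(1) unfolding PGL_orbit_eq by blast
  obtain N where N: "invertible N" "N ** M = mat 1" using invertible_inverse[OF M(1)] by blast
  have "B j = act N (B' j)" if "j \<in> {1..n}" for j
    using M(2)[OF that] N by (simp add: act_act M(1))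
  then show ?thesis using assms(2) N(1) unfolding PGL_orbit_eq by blast
qed

lemma PGL_orbit_trans:
  assumes "B' \<in> PGL_orbit n B" "B'' \<in> PGL_orbit n B'"
  shows "B'' \<in> PGL_orbit n B"
proof -
  obtain M where M: "invertible M" "\<And>j. j \<in> {1..n} \<Longrightarrow> B' j = act M (B j)"
    using assms(1) unfolding PGL_orbit_eq by blast
  obtain N where N: "invertible N" "\<And>j. j \<in> {1..n} \<Longrightarrow> B'' j = act N (B' j)"
    using assms(2) unfolding PGL_orbit_eq by blast
  have "B'' j = act (N ** M) (B j)" if "j \<in> {1..n}" for j
    using M(2)[OF that] N(2)[OF that] by (simp add: act_act M(1) N(1))
  moreover have "invertible (N ** M)" using invertible_mult N(1) M(1) by blast
  ultimately show ?thesis using assms(2) unfolding PGL_orbit_eq by blast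
qed

lemma PGL_orbit_eqI:
  assumes "B' \<in> PGL_orbit n B" "B \<in> {1..n} \<rightarrow>\<^sub>E UNIV"
  shows "PGL_orbit n B' = PGL_orbit n B"
  using PGL_orbit_trans PGL_orbit_sym[OF assms] assms(1) by blast

lemma realizes_extensional: "realizes n C A \<Longrightarrow> A \<in> {1..n} \<rightarrow>\<^sub>E UNIV"
  unfolding realizes_def arrangement_def by blast

lemma realizes_orbit:
  assumes B: "realizes n C B" and B': "B' \<in> PGL_orbit n B"
  shows "realizes n C B'"
proof -
  obtain M where M: "invertible M" "\<And>j. j \<in> {1..n} \<Longrightarrow> B' j = act M (B j)"
    using B' unfolding PGL_orbit_eq by blast
  have e: "B' \<in> {1..n} \<rightarrow>\<^sub>E UNIV" using B' unfolding PGL_orbit_eq by blast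
  have "inj_on B' {1..n}"
  proof (rule inj_onI)
    fix i j assume ij: "i \<in> {1..n}" "j \<in> {1..n}" "B' i = B' j"
    then have "B i = B j" using M(2)[of i] M(2)[of j] act_inject[OF M(1)] by metis
    then show "i = j" using realizes_distinct[OF B ij(1,2)] by blast
  qed
  moreover have "concurrent (B' i) (B' j) (B' k) = concurrent_triple C i j k"
    if "i \<in> {1..n}" "j \<in> {1..n}" "k \<in> {1..n}" "i \<noteq> j" "i \<noteq> k" "j \<noteq> k" for i j k
    using realizes_concurrent[OF B that] M(2)[OF that(1)] M(2)[OF that(2)] M(2)[OF that(3)]
    by (simp add: concurrent_act[OF M(1)])
  ultimately show ?thesis using e unfolding realizes_def arrangement_def by blast
qed

text \<open>The fundamental theorem on projective frames, applied in the dual plane.\<close>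

lemma projective_frame:
  assumes abc: "\<not> concurrent a b c" and abd: "\<not> concurrent a b d"
    and acd: "\<not> concurrent a c d" and bcd: "\<not> concurrent b c d"
  obtains M where "invertible M" "act M a = proj (vector [1, 0, 0])"
    "act M b = proj (vector [0, 1, 0])" "act M c = proj (vector [0, 0, 1])"
    "act M d = proj (vector [1, 1, 1])"
proof -
  define u v w x where uvwx: "u = rep_cp2 a" "v = rep_cp2 b" "w = rep_cp2 c" "x = rep_cp2 d"
  have nz: "u \<noteq> 0" "v \<noteq> 0" "w \<noteq> 0" "x \<noteq> 0"
    and p: "a = proj u" "b = proj v" "c = proj w" "d = proj x" by (simp_all add: uvwx)
  define \<alpha> \<beta> \<gamma> \<delta> where coeffs: "\<alpha> = bracket x v w" "\<beta> = bracket u x w" "\<gamma> = bracket u v x"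
    "\<delta> = bracket u v w"
  have c0: "\<alpha> \<noteq> 0" "\<beta> \<noteq> 0" "\<gamma> \<noteq> 0" "\<delta> \<noteq> 0"
  proof -
    have "bracket v w x = \<alpha>" unfolding coeffs using bracket_rotate by metis
    moreover have "bracket u w x = - \<beta>" unfolding coeffs using bracket_permute(2) by blast
    ultimately show "\<alpha> \<noteq> 0" "\<beta> \<noteq> 0" "\<gamma> \<noteq> 0" "\<delta> \<noteq> 0"
      using assms by (auto simp: concurrent_def uvwx[symmetric] coeffs)
  qed
  \<comment> \<open>The columns are the first three vectors, scaled by Cramer's rule so that they
    add up to \<open>\<delta> *s x\<close>. Thus \<open>K\<close> carries the standard frame to the
    four lines, and its inverse is the required matrix.\<close>
  define K :: "complex^3^3" where "K = transpose (vector [\<alpha> *s u, \<beta> *s v, \<gamma> *s w])"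
  have "det K = \<alpha> * \<beta> * \<gamma> * \<delta>"
    unfolding K_def det_transpose bracket_eq_det[symmetric] bracket_scale coeffs ..
  then have "invertible K" using c0 by (simp add: invertible_det_nz)
  then obtain M where M: "invertible M" "M ** K = mat 1" using invertible_inverse by blast
  have K: "K *v vector [1, 0, 0] = \<alpha> *s u" "K *v vector [0, 1, 0] = \<beta> *s v"
    "K *v vector [0, 0, 1] = \<gamma> *s w"
    "K *v vector [1, 1, 1] = \<alpha> *s u + \<beta> *s v + \<gamma> *s w"
    by (simp_all add: K_def matrix_vector_mult_def transpose_def sum_3 vec_eq_iff)
  then have K4: "K *v vector [1, 1, 1] = \<delta> *s x"
    using cramer_bracket[of u v w x] by (simp add: coeffs)
  have inv: "M *v (k *s y) = k *s (M *v y)" "M *v (K *v y) = y" for k y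
    by (simp_all add: vector_scalar_commute matrix_vector_mul_assoc M(2))
  have scale: "act M (proj y) = proj e" if "K *v e = k *s y" "k \<noteq> 0" "y \<noteq> 0" "e \<noteq> 0" for k y e
  proof -
    have "e = k *s (M *v y)" using arg_cong[OF that(1), of "\<lambda>z. M *v z"] by (simp add: inv)
    then show ?thesis
      using act_proj[OF M(1) that(3)] proj_scale[OF that(2) invertible_mult_nonzero[OF M(1) that(3)]]
      by simp
  qed
  have e: "(vector [1, 0, 0] :: complex^3) \<noteq> 0" "(vector [0, 1, 0] :: complex^3) \<noteq> 0"
    "(vector [0, 0, 1] :: complex^3) \<noteq> 0" "(vector [1, 1, 1] :: complex^3) \<noteq> 0"
    by (simp_all add: vec_eq_iff forall_3)
  show ?thesis
    by (rule that[OF M(1)])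
      (unfold p, rule scale[OF K(1) c0(1) nz(1) e(1)], rule scale[OF K(2) c0(2) nz(2) e(2)],
        rule scale[OF K(3) c0(3) nz(3) e(3)], rule scale[OF K4 c0(4) nz(4) e(4)])
qed

section \<open>The cross ratio\<close>

text \<open>
  In coordinates with \<open>a\<close>, \<open>b\<close>, \<open>c\<close>, \<open>d\<close> the standard frame, the relation says that
  the first two coordinates of \<open>l\<close> have ratio \<open>t\<close>.
\<close>

definition cross_ratio_vec :: "complex \<Rightarrow> complex^3 \<Rightarrow> complex^3 \<Rightarrow> complex^3 \<Rightarrow> complex^3 \<Rightarrow> complex^3 \<Rightarrow> bool"
  where "cross_ratio_vec t a b c d l \<longleftrightarrow>
    bracket l b c * bracket a d c = t * (bracket a l c * bracket d b c)"

definition cross_ratio :: "complex \<Rightarrow> cp2 \<Rightarrow> cp2 \<Rightarrow> cp2 \<Rightarrow> cp2 \<Rightarrow> cp2 \<Rightarrow> bool"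
  where "cross_ratio t a b c d l \<longleftrightarrow>
    cross_ratio_vec t (rep_cp2 a) (rep_cp2 b) (rep_cp2 c) (rep_cp2 d) (rep_cp2 l)"

text \<open>Both sides have the same degree in each vector: two in \<open>c\<close>, one in each of
  the others.\<close>

lemma cross_ratio_vec_scale:
  assumes "\<alpha> \<noteq> 0" "\<beta> \<noteq> 0" "\<gamma> \<noteq> 0" "\<delta> \<noteq> 0" "\<epsilon> \<noteq> 0"
  shows "cross_ratio_vec t (\<alpha> *s a) (\<beta> *s b) (\<gamma> *s c) (\<delta> *s d) (\<epsilon> *s l) \<longleftrightarrow>
    cross_ratio_vec t a b c d l"
proof -
  have "cross_ratio_vec t (\<alpha> *s a) (\<beta> *s b) (\<gamma> *s c) (\<delta> *s d) (\<epsilon> *s l) \<longleftrightarrow>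
    (\<alpha> * \<beta> * \<gamma> * \<gamma> * \<delta> * \<epsilon>) * (bracket l b c * bracket a d c) =
    (\<alpha> * \<beta> * \<gamma> * \<gamma> * \<delta> * \<epsilon>) * (t * (bracket a l c * bracket d b c))"
    by (simp only: cross_ratio_vec_def bracket_scale mult_ac)
  then show ?thesis using assms by (simp add: cross_ratio_vec_def)
qed

lemma cross_ratio_proj:
  assumes "a \<noteq> 0" "b \<noteq> 0" "c \<noteq> 0" "d \<noteq> 0" "l \<noteq> 0"
  shows "cross_ratio t (proj a) (proj b) (proj c) (proj d) (proj l) \<longleftrightarrow> cross_ratio_vec t a b c d l"
proof -
  obtain \<alpha> \<beta> \<gamma> \<delta> \<epsilon> where "\<alpha> \<noteq> 0" "rep_cp2 (proj a) = \<alpha> *s a" "\<beta> \<noteq> 0" "rep_cp2 (proj b) = \<beta> *s b"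
    "\<gamma> \<noteq> 0" "rep_cp2 (proj c) = \<gamma> *s c" "\<delta> \<noteq> 0" "rep_cp2 (proj d) = \<delta> *s d"
    "\<epsilon> \<noteq> 0" "rep_cp2 (proj l) = \<epsilon> *s l"
    using rep_cp2_proj assms by metis
  then show ?thesis by (simp add: cross_ratio_def cross_ratio_vec_scale)
qed

lemma cross_ratio_act:
  assumes M: "invertible M"
  shows "cross_ratio t (act M a) (act M b) (act M c) (act M d) (act M l) \<longleftrightarrow> cross_ratio t a b c d l"
proof -
  have "det M \<noteq> 0" using M by (simp add: invertible_det_nz)
  moreover have "cross_ratio_vec t (M *v u) (M *v v) (M *v w) (M *v x) (M *v y) \<longleftrightarrow>
    (det M * det M) * (bracket y v w * bracket u x w) =
    (det M * det M) * (t * (bracket u y w * bracket x v w))" for u v w x y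
    by (simp only: cross_ratio_vec_def bracket_mult mult_ac)
  ultimately have "cross_ratio_vec t (M *v u) (M *v v) (M *v w) (M *v x) (M *v y) \<longleftrightarrow>
      cross_ratio_vec t u v w x y" for u v w x y
    by (simp add: cross_ratio_vec_def)
  then show ?thesis
    unfolding act_def by (subst cross_ratio_proj) (simp_all add: invertible_mult_nonzero[OF M] cross_ratio_def)
qed

lemma cross_ratio_unique:
  assumes "cross_ratio s a b c d l" "cross_ratio t a b c d l"
    and "\<not> concurrent a l c" "\<not> concurrent d b c"
  shows "s = t"
  using assms by (simp add: cross_ratio_def cross_ratio_vec_def concurrent_def)

section \<open>The topology of the moduli space\<close>

lemma continuous_on_scale: "continuous_on S (\<lambda>v :: complex^3. c *s v)"
  unfolding vector_scalar_mult_def by (intro continuous_intros)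

text \<open>The map \<open>proj\<close> is open, since the saturation of a set of vectors is the
  union of its nonzero multiples.\<close>

lemma open_proj_image:
  assumes "open W"
  shows "open (proj ` (W - {0}))"
proof -
  have "{v. v \<noteq> 0 \<and> proj v \<in> proj ` (W - {0})} = (\<Union>c \<in> - {0}. (*s) c -` (W - {0}))"
    (is "?L = ?R")
  proof (intro equalityI subsetI)
    fix v assume "v \<in> ?L"
    then obtain w where w: "v \<noteq> 0" "w \<in> W - {0}" "proj v = proj w" by blast
    then obtain c where "c \<noteq> 0" "w = c *s v" using proj_eq_iff[of v w] by blast
    then show "v \<in> ?R" using w by blast
  next
    fix v assume "v \<in> ?R"
    then obtain c where c: "c \<noteq> 0" "c *s v \<in> W - {0}" by blast
    then have "v \<noteq> 0" by auto
    moreover from this have "proj v = proj (c *s v)" using proj_scale[OF c(1)] by simp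
    ultimately show "v \<in> ?L" using c(2) by blast
  qed
  moreover have "open ((*s) c -` (W - {0}))" for c :: complex
    by (rule open_vimage) (use assms in \<open>auto simp: continuous_on_scale intro: open_delete\<close>)
  ultimately show ?thesis unfolding open_cp2_def by auto
qed

text \<open>For tuples of vectors the condition is that a polynomial does not vanish, which is open.
  A box around the representatives is then projected factor by factor with the open map
  \<open>proj\<close>.\<close>

lemma openin_not_cross_ratio:
  fixes n :: nat
  assumes idx: "{a, b, c, d, l} \<subseteq> {1..n}"
  shows "openin (product_topology (\<lambda>_. euclidean) {1..n})
    {B \<in> {1..n} \<rightarrow>\<^sub>E UNIV. \<not> cross_ratio t (B a) (B b) (B c) (B d) (B l)}"
    (is "openin ?X ?U")
proof (subst openin_subopen, intro ballI)
  fix B assume B: "B \<in> ?U"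
  define v where "v i = rep_cp2 (B i)" for i
  define W where "W = {w :: nat \<Rightarrow> complex^3. \<not> cross_ratio_vec t (w a) (w b) (w c) (w d) (w l)}"
  define F where "F w = bracket (w l) (w b) (w c) * bracket (w a) (w d) (w c)
      - t * (bracket (w a) (w l) (w c) * bracket (w d) (w b) (w c))" for w :: "nat \<Rightarrow> complex^3"
  have coord: "continuous_on UNIV (\<lambda>w :: nat \<Rightarrow> complex^3. w i $ j)" for i j
    by (rule continuous_on_component, rule continuous_on_product_coordinates)
  have "continuous_on UNIV F"
    unfolding F_def bracket_def
    by (rule continuous_on_add continuous_on_diff continuous_on_mult continuous_on_const coord)+
  moreover have "W = F -` (- {0})"
    by (auto simp: W_def F_def cross_ratio_vec_def)
  ultimately have "open W" by (simp add: open_vimage open_Compl)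
  then have W: "openin (product_topology (\<lambda>_. euclidean) UNIV) W" by (simp add: open_fun_def)
  have "v \<in> W" using B by (simp add: W_def v_def cross_ratio_def)
  from product_topology_open_contains_basis[OF W this] obtain X where
    X: "v \<in> (\<Pi>\<^sub>E i\<in>UNIV. X i)" "\<And>i. open (X i)" "(\<Pi>\<^sub>E i\<in>UNIV. X i) \<subseteq> W"
    by (elim exE conjE) (simp only: open_openin)
  define T where "T = (\<Pi>\<^sub>E i\<in>{1..n}. proj ` (X i - {0}))"
  have "openin ?X T"
    unfolding T_def by (rule openin_PiE[THEN iffD2]) (auto intro: open_proj_image X(2))
  moreover have "B \<in> T"
  proof -
    have "B i \<in> proj ` (X i - {0})" for i
      using X(1) by (intro image_eqI[of _ _ "v i"]) (auto simp: v_def PiE_iff)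
    then show ?thesis using B by (auto simp: T_def PiE_iff)
  qed
  moreover have "T \<subseteq> ?U"
  proof
    fix B' assume B': "B' \<in> T"
    then have "\<forall>i\<in>{1..n}. \<exists>w. w \<in> X i \<and> w \<noteq> 0 \<and> B' i = proj w" by (auto simp: T_def PiE_iff)
    then obtain w where w: "\<And>i. i \<in> {1..n} \<Longrightarrow> w i \<in> X i \<and> w i \<noteq> 0 \<and> B' i = proj (w i)"
      by metis
    \<comment> \<open>The box \<open>X\<close> is indexed by all naturals, whereas new vectors are
      known only for the labels; the old ones fill the other places.\<close>
    define w' where "w' i = (if i \<in> {1..n} then w i else v i)" for i
    have "w' \<in> W" using w X(1,3) by (force simp: w'_def PiE_iff)
    then have "\<not> cross_ratio_vec t (w a) (w b) (w c) (w d) (w l)"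
      using idx by (simp add: W_def w'_def)
    then show "B' \<in> ?U" using B' w idx by (auto simp: T_def PiE_iff cross_ratio_proj)
  qed
  ultimately show "\<exists>T. openin ?X T \<and> B \<in> T \<and> T \<subseteq> ?U" by blast
qed

lemma cross_ratio_orbit:
  assumes "B' \<in> PGL_orbit n B" "{a, b, c, d, l} \<subseteq> {1..n}"
  shows "cross_ratio t (B' a) (B' b) (B' c) (B' d) (B' l) \<longleftrightarrow> cross_ratio t (B a) (B b) (B c) (B d) (B l)"
proof -
  obtain M where "invertible M" "\<And>j. j \<in> {1..n} \<Longrightarrow> B' j = act M (B j)"
    using assms(1) unfolding PGL_orbit_eq by blast
  then show ?thesis using assms(2) by (simp add: cross_ratio_act)
qed

text \<open>By \<open>cover\<close> exactly one of the two values is attained by each realization,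
  and by \<open>orbit\<close> the value determines the class.\<close>

lemma moduli_space_two_points:
  assumes idx: "{a, b, c, d, l} \<subseteq> {1..n}"
    and A: "realizes n C A"
    and cover: "\<And>B. realizes n C B \<Longrightarrow>
      cross_ratio s (B a) (B b) (B c) (B d) (B l) \<noteq> cross_ratio t (B a) (B b) (B c) (B d) (B l)"
    and orbit: "\<And>r B B'. r \<in> {s, t} \<Longrightarrow> realizes n C B \<Longrightarrow> realizes n C B' \<Longrightarrow>
      cross_ratio r (B a) (B b) (B c) (B d) (B l) \<Longrightarrow>
      cross_ratio r (B' a) (B' b) (B' c) (B' d) (B' l) \<Longrightarrow> B' \<in> PGL_orbit n B"
    and S: "realizes n C S" "cross_ratio s (S a) (S b) (S c) (S d) (S l)"
    and T: "realizes n C T" "cross_ratio t (T a) (T b) (T c) (T d) (T l)"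
  shows "moduli_space n A = discrete_topology {PGL_orbit n S, PGL_orbit n T}"
    and "PGL_orbit n S \<noteq> PGL_orbit n T"
proof -
  let ?R = "\<lambda>r B. cross_ratio r (B a) (B b) (B c) (B d) (B l)"
  have top: "topspace (realization_space n A) = {B. realizes n C B}"
    unfolding realization_space_def realizations_eq[OF A]
    using realizes_extensional by (auto simp: topspace_product_topology)
  have same: "PGL_orbit n B = PGL_orbit n B' \<longleftrightarrow> ?R r B"
    if "r \<in> {s, t}" "realizes n C B" "realizes n C B'" "?R r B'" for r B B'
  proof
    assume "PGL_orbit n B = PGL_orbit n B'"
    then have "B \<in> PGL_orbit n B'" using PGL_orbit_refl[OF realizes_extensional[OF that(2)]] by simp
    then show "?R r B" using cross_ratio_orbit[OF _ idx] that(4) by blast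
  next
    assume "?R r B"
    from orbit[OF that(1,3,2,4) this] show "PGL_orbit n B = PGL_orbit n B'"
      by (rule PGL_orbit_eqI) (rule realizes_extensional[OF that(3)])
  qed
  show ne: "PGL_orbit n S \<noteq> PGL_orbit n T"
    using same[of t S T] T S cover[OF S(1)] by simp
  have img: "PGL_orbit n ` {B. realizes n C B} = {PGL_orbit n S, PGL_orbit n T}"
  proof -
    have "PGL_orbit n B \<in> {PGL_orbit n S, PGL_orbit n T}" if B: "realizes n C B" for B
      using same[of s B S] same[of t B T] S T B cover[OF B] by auto
    then show ?thesis using S(1) T(1) by blast
  qed
  have op: "openin (realization_space n A) {B. realizes n C B \<and> \<not> ?R r B}" for r
  proof -
    have "{B. realizes n C B \<and> \<not> ?R r B} = {B \<in> {1..n} \<rightarrow>\<^sub>E UNIV. \<not> ?R r B} \<inter> {B. realizes n C B}"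
      using realizes_extensional by blast
    then show ?thesis
      unfolding realization_space_def realizations_eq[OF A] openin_subtopology
      using openin_not_cross_ratio[OF idx] by blast
  qed
  \<comment> \<open>Each orbit is described by the failure of the other value, because failure is
    what has been shown to be open.\<close>
  have e: "PGL_orbit n B = PGL_orbit n S \<longleftrightarrow> \<not> ?R t B"
    "PGL_orbit n B = PGL_orbit n T \<longleftrightarrow> \<not> ?R s B" if B: "realizes n C B" for B
    using same[of s B S] same[of t B T] S T cover[OF B] B by simp_all
  have pre: "{B \<in> {B. realizes n C B}. PGL_orbit n B \<in> {PGL_orbit n S}} = {B. realizes n C B \<and> \<not> ?R t B}"
    "{B \<in> {B. realizes n C B}. PGL_orbit n B \<in> {PGL_orbit n T}} = {B. realizes n C B \<and> \<not> ?R s B}"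
    by (simp_all add: e cong: conj_cong)
  have "openin (moduli_space n A) {PGL_orbit n S}" "openin (moduli_space n A) {PGL_orbit n T}"
    unfolding moduli_space_def openin_quotient_topology top pre using op img by auto
  then show "moduli_space n A = discrete_topology {PGL_orbit n S, PGL_orbit n T}"
    by (intro discrete_topology_unique[THEN iffD2, symmetric])
      (auto simp: moduli_space_def topspace_quotient_topology top img)
qed

section \<open>The swap of coordinates\<close>

definition swap_matrix :: "complex^3^3" where
  "swap_matrix = vector [vector [0, 1, 0], vector [1, 0, 0], vector [0, 0, 1]]"

lemma swap_matrix_mult: "swap_matrix *v v = vector [v$2, v$1, v$3]"
  by (simp add: swap_matrix_def matrix_vector_mult_def vec_eq_iff forall_3 sum_3)

lemma swap_matrix_self_inverse: "swap_matrix ** swap_matrix = mat 1"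
  by (simp add: swap_matrix_def matrix_matrix_mult_def mat_def vec_eq_iff forall_3 sum_3)

lemma transpose_swap_matrix: "transpose swap_matrix = swap_matrix"
  by (simp add: swap_matrix_def transpose_def vec_eq_iff forall_3)

lemma invertible_swap_matrix: "invertible swap_matrix"
  using swap_matrix_self_inverse unfolding invertible_def by blast

lemma swap_xy_eq_proj:
  assumes "v \<noteq> 0"
  shows "swap_xy (proj v) = proj (swap_matrix *v v)"
proof -
  have v: "v = vector [v$1, v$2, v$3]" by (simp add: vec_eq_iff forall_3)
  have "(v$1, v$2, v$3) \<noteq> (0, 0, 0)" using assms by (auto simp: vec_eq_iff forall_3)
  from swap_xy_proj[OF this] show ?thesis unfolding swap_matrix_mult v[symmetric] .
qed

lemma swap_xy_line: "swap_xy ` line l = line (act swap_matrix l)"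
  by (rule image_line[OF swap_xy_eq_proj])
    (simp_all add: transpose_swap_matrix swap_matrix_self_inverse invertible_swap_matrix)

lemma swap_xy_swap_xy [simp]: "swap_xy (swap_xy p) = p"
proof -
  obtain v where v: "v \<noteq> 0" "p = proj v" using proj_surj by metis
  then show ?thesis
    using invertible_mult_nonzero[OF invertible_swap_matrix v(1)]
    by (simp add: swap_xy_eq_proj matrix_vector_mul_assoc swap_matrix_self_inverse)
qed

lemma continuous_on_swap_xy: "continuous_on S swap_xy"
proof -
  have "continuous_on UNIV swap_xy"
    unfolding continuous_on_open_vimage[OF open_UNIV]
  proof (intro allI impI)
    fix U :: "cp2 set" assume "open U"
    then have "open {v. v \<noteq> 0 \<and> proj v \<in> U}" by (simp add: open_cp2_def)
    moreover have "{v. v \<noteq> 0 \<and> proj v \<in> swap_xy -` U} = (*v) swap_matrix -` {v. v \<noteq> 0 \<and> proj v \<in> U}"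
    proof (rule Set.set_eqI)
      fix v
      show "v \<in> {v. v \<noteq> 0 \<and> proj v \<in> swap_xy -` U} \<longleftrightarrow>
          v \<in> (*v) swap_matrix -` {v. v \<noteq> 0 \<and> proj v \<in> U}"
        using invertible_mult_nonzero[OF invertible_swap_matrix, of v]
        by (cases "v = 0") (simp_all add: swap_xy_eq_proj)
    qed
    moreover have "continuous_on UNIV ((*v) swap_matrix)"
      unfolding matrix_vector_mult_def by (intro continuous_intros)
    ultimately have "open {v. v \<noteq> 0 \<and> proj v \<in> swap_xy -` U}"
      by (simp only: open_vimage)
    then show "open (swap_xy -` U \<inter> UNIV)" by (simp add: open_cp2_def)
  qed
  then show ?thesis by (rule continuous_on_subset) simp
qed

lemma homeomorphism_complement_swap:
  assumes \<tau>: "\<tau> permutes {1..n}" and B: "\<And>j. j \<in> {1..n} \<Longrightarrow> B j = act swap_matrix (A (\<tau> j))"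
  shows "homeomorphism (complement n A) (complement n B) swap_xy swap_xy"
proof -
  have "(\<Union>j\<in>{1..n}. line (B j)) = (\<Union>j\<in>{1..n}. swap_xy ` line (A (\<tau> j)))"
    using B by (simp add: swap_xy_line)
  also have "\<dots> = swap_xy ` (\<Union>j\<in>\<tau> ` {1..n}. line (A j))" by blast
  also have "\<dots> = swap_xy ` (\<Union>j\<in>{1..n}. line (A j))" by (simp only: permutes_image[OF \<tau>])
  finally have eq: "(\<Union>j\<in>{1..n}. line (B j)) = swap_xy ` (\<Union>j\<in>{1..n}. line (A j))" .
  have mem: "swap_xy p \<in> swap_xy ` X \<longleftrightarrow> p \<in> X" for p X
    by (rule inj_image_mem_iff) (metis injI swap_xy_swap_xy)
  then have mem': "swap_xy p \<in> X \<longleftrightarrow> p \<in> swap_xy ` X" for p X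
    using mem[of "swap_xy p" X] by simp
  have "swap_xy ` complement n A \<subseteq> complement n B"
    unfolding complement_def eq using mem by blast
  moreover have "swap_xy ` complement n B \<subseteq> complement n A"
    unfolding complement_def eq using mem' by blast
  ultimately show ?thesis
    by (intro homeomorphismI continuous_on_swap_xy) simp_all
qed

section \<open>Combinatorics realized over the golden ratio\<close>

lemma iso_integer_mod_group_2:
  assumes H: "subgroup {\<one>\<^bsub>G\<^esub>, x} G" and x: "x \<noteq> \<one>\<^bsub>G\<^esub>" "x \<otimes>\<^bsub>G\<^esub> x = \<one>\<^bsub>G\<^esub>" and G: "group G"
  shows "G\<lparr>carrier := {\<one>\<^bsub>G\<^esub>, x}\<rparr> \<cong> integer_mod_group 2"
proof -
  interpret group G by (rule G)
  have xG: "x \<in> carrier G" using subgroup.subset[OF H] by blast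
  define h where "h g = (if g = \<one>\<^bsub>G\<^esub> then 0 else 1 :: int)" for g
  have "h \<in> iso (G\<lparr>carrier := {\<one>\<^bsub>G\<^esub>, x}\<rparr>) (integer_mod_group 2)"
  proof (rule isoI)
    show "h \<in> hom (G\<lparr>carrier := {\<one>\<^bsub>G\<^esub>, x}\<rparr>) (integer_mod_group 2)"
      using x xG by (auto simp: hom_def h_def carrier_integer_mod_group)
    have "{0..<int 2} = {0, 1}" by auto
    then show "bij_betw h (carrier (G\<lparr>carrier := {\<one>\<^bsub>G\<^esub>, x}\<rparr>)) (carrier (integer_mod_group 2))"
      using x(1) by (auto simp: bij_betw_def inj_on_def h_def carrier_integer_mod_group)
  qed
  then show ?thesis unfolding is_iso_def by blast
qed

section \<open>The golden quadratic and its two roots, whose sum is 1\<close>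

definition golden :: "complex \<Rightarrow> bool" where
  "golden t \<longleftrightarrow> t * t = t + 1"

lemma golden_cases:
  assumes "golden s" "golden t"
  shows "t = s \<or> t = 1 - s"
proof -
  have "(t - s) * (t - (1 - s)) = (t * t - t) - (s * s - s)" by (simp add: algebra_simps)
  then have "(t - s) * (t - (1 - s)) = 0" using assms by (simp add: golden_def)
  then show ?thesis by auto
qed

text \<open>The discriminant is 5; concretely, 2t = 1 would turn four times the quadratic equation
  into 1 = 6.\<close>

lemma golden_neq_conjugate:
  assumes "golden t"
  shows "1 - t \<noteq> t"
proof
  assume "1 - t = t"
  then have t: "2 * t = 1" by (simp add: algebra_simps)
  have "(2 * t) * (2 * t) = 4 * (t * t)" by simp
  also have "\<dots> = 2 * (2 * t) + 4" using assms by (simp add: golden_def)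
  finally show False unfolding t by simp
qed

lemma golden_exists: "\<exists>t. golden t"
proof
  have "complex_of_real (sqrt 5) * complex_of_real (sqrt 5) = 5"
    by (metis abs_numeral of_real_mult of_real_numeral real_sqrt_mult_self)
  then show "golden ((1 + complex_of_real (sqrt 5)) / 2)"
    by (simp add: golden_def field_simps)
qed

section \<open>Recovering lines by joins, up to scalars\<close>

definition parallel :: "complex^3 \<Rightarrow> complex^3 \<Rightarrow> bool" where
  "parallel v w \<longleftrightarrow> (\<exists>k. k \<noteq> 0 \<and> v = k *s w)"

lemma parallel_refl: "parallel v v"
  unfolding parallel_def by (rule exI[of _ 1]) simp

lemma parallel_bracket:
  assumes "parallel u u'" "parallel v v'" "parallel w w'"
  shows "bracket u v w = 0 \<longleftrightarrow> bracket u' v' w' = 0"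
  using assms by (auto simp: parallel_def bracket_scale)

definition realizes_vec :: "nat set set \<Rightarrow> (nat \<Rightarrow> complex^3) \<Rightarrow> bool" where
  "realizes_vec C v \<longleftrightarrow> (\<forall>i\<in>{1..10}. v i \<noteq> 0) \<and>
    (\<forall>i\<in>{1..10}. \<forall>j\<in>{1..10}. \<forall>k\<in>{1..10}. i \<noteq> j \<longrightarrow> i \<noteq> k \<longrightarrow> j \<noteq> k \<longrightarrow>
      (bracket (v i) (v j) (v k) = 0 \<longleftrightarrow> concurrent_triple C i j k))"

lemma realizes_vec_bracket:
  assumes "realizes_vec C v" "{i, j, k} \<subseteq> {1..10}" "distinct [i, j, k]"
  shows "bracket (v i) (v j) (v k) = 0 \<longleftrightarrow> concurrent_triple C i j k"
  using assms by (simp add: realizes_vec_def)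

text \<open>In a join step the line \<open>k\<close> is recovered as the line through the points \<open>p \<inter> q\<close> and \<open>r \<inter> s\<close>.\<close>

definition join_step :: "nat set set \<Rightarrow> nat \<Rightarrow> nat \<Rightarrow> nat \<Rightarrow> nat \<Rightarrow> nat \<Rightarrow> bool" where
  "join_step C p q r s k \<longleftrightarrow> {p, q, r, s, k} \<subseteq> {1..10} \<and> distinct [p, q, r, s, k] \<and>
    concurrent_triple C p q k \<and> concurrent_triple C r s k \<and>
    \<not> concurrent_triple C p q r \<and> \<not> concurrent_triple C p r s"

text \<open>The two nonconcurrencies in \<open>join_step\<close> are exactly the nondegeneracy
  conditions of \<open>meet_unique\<close>, so any explicit solution \<open>w\<close> of the two
  incidences must be the line \<open>k\<close>.\<close>

lemma join_step_parallel:
  assumes v: "realizes_vec C v" and step: "join_step C p q r s k"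
    and P: "parallel (v p) P" "parallel (v q) Q" "parallel (v r) R" "parallel (v s) S"
    and w: "w \<noteq> 0" "bracket P Q w = 0" "bracket R S w = 0"
  shows "parallel (v k) w"
  unfolding parallel_def
proof (rule meet_unique[of "v p" "v q" "v r" "v s"])
  have sub: "{p, q, r, s, k} \<subseteq> {1..10}" and dist: "distinct [p, q, r, s, k]"
    and conc: "concurrent_triple C p q k" "concurrent_triple C r s k"
    and nconc: "\<not> concurrent_triple C p q r" "\<not> concurrent_triple C p r s"
    using step unfolding join_step_def by blast+
  note br = realizes_vec_bracket[OF v]
  show "bracket (v p) (v q) (v r) \<noteq> 0" "bracket (v p) (v r) (v s) \<noteq> 0"
    using br[of p q r] br[of p r s] nconc sub dist by auto
  show "bracket (v p) (v q) (v k) = 0" "bracket (v r) (v s) (v k) = 0"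
    using br[of p q k] br[of r s k] conc sub dist by auto
  show "v k \<noteq> 0" using v sub by (simp add: realizes_vec_def)
  show "bracket (v p) (v q) w = 0" "bracket (v r) (v s) w = 0"
    using parallel_bracket[OF P(1,2) parallel_refl, of w] parallel_bracket[OF P(3,4) parallel_refl, of w]
      w(2,3) by simp_all
qed (rule w(1))

text \<open>
  The lines \<open>a\<close>, \<open>b\<close>, \<open>c\<close>, \<open>d\<close> serve as a projective frame, the first two coordinates of \<open>l\<close> have
  ratio \<open>t\<close>, and these five lines determine the others by join steps. The involution \<open>\<tau>\<close> exchanges
  the two roots \<open>t\<close> and \<open>1 - t\<close>.
\<close>

locale golden_combinatorics =
  fixes C :: "nat set set" and a b c d l :: nat
    and N :: "complex \<Rightarrow> nat \<Rightarrow> complex^3" and \<tau> :: "nat \<Rightarrow> nat"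
  assumes idx: "{a, b, c, d, l} \<subseteq> {1..10}" and frame_distinct: "distinct [a, b, c, d, l]"
    and frame: "\<not> concurrent_triple C a b c" "\<not> concurrent_triple C a b d"
      "\<not> concurrent_triple C a c d" "\<not> concurrent_triple C b c d" "\<not> concurrent_triple C a l c"
    and blocks: "\<And>X. X \<in> C \<Longrightarrow> X \<subseteq> {1..10} \<and> 3 \<le> card X"
    and linear: "\<And>X Y i j. X \<in> C \<Longrightarrow> Y \<in> C \<Longrightarrow> i \<in> X \<inter> Y \<Longrightarrow> j \<in> X \<inter> Y \<Longrightarrow> i \<noteq> j \<Longrightarrow> X = Y"
    and spanning: "\<And>i j. i \<in> {1..10} \<Longrightarrow> j \<in> {1..10} \<Longrightarrow> i \<noteq> j \<Longrightarrow>
      \<exists>k\<in>{1..10} - {i, j}. \<not> concurrent_triple C i j k"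
    and N_bracket: "\<And>t i j k. golden t \<Longrightarrow> i \<in> {1..10} \<Longrightarrow> j \<in> {1..10} \<Longrightarrow> k \<in> {1..10} \<Longrightarrow>
      i \<noteq> j \<Longrightarrow> i \<noteq> k \<Longrightarrow> j \<noteq> k \<Longrightarrow>
      bracket (N t i) (N t j) (N t k) = 0 \<longleftrightarrow> concurrent_triple C i j k"
    and N_frame: "\<And>t. N t a = vector [1, 0, 0]" "\<And>t. N t b = vector [0, 1, 0]"
      "\<And>t. N t c = vector [0, 0, 1]" "\<And>t. N t d = vector [1, 1, 1]"
    and N_free: "\<And>t. N t l $ 1 = t" "\<And>t. N t l $ 2 = 1"
    and golden_free: "\<And>v. realizes_vec C v \<Longrightarrow> v a = vector [1, 0, 0] \<Longrightarrow>
      v b = vector [0, 1, 0] \<Longrightarrow> v c = vector [0, 0, 1] \<Longrightarrow> v d = vector [1, 1, 1] \<Longrightarrow>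
      \<exists>t. golden t \<and> parallel (v l) (N t l)"
    and rigid: "\<And>P. P a \<Longrightarrow> P b \<Longrightarrow> P c \<Longrightarrow> P d \<Longrightarrow> P l \<Longrightarrow>
      (\<And>p q r s k. join_step C p q r s k \<Longrightarrow> P p \<Longrightarrow> P q \<Longrightarrow> P r \<Longrightarrow> P s \<Longrightarrow> P k) \<Longrightarrow>
      \<forall>j\<in>{1..10}. P j"
    and \<tau>: "\<tau> permutes {1..10}" "\<tau> \<circ> \<tau> = id" "\<tau> \<noteq> id"
    and \<tau>_concurrent: "\<And>i j k. {i, j, k} \<subseteq> {1..10} \<Longrightarrow>
      concurrent_triple C (\<tau> i) (\<tau> j) (\<tau> k) \<longleftrightarrow> concurrent_triple C i j k"
    and \<tau>_cross_ratio: "\<And>t. golden t \<Longrightarrow>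
      cross_ratio_vec (1 - t) (N t (\<tau> a)) (N t (\<tau> b)) (N t (\<tau> c)) (N t (\<tau> d)) (N t (\<tau> l))"
begin

section \<open>The standard realizations and their orbits\<close>

definition standard :: "complex \<Rightarrow> nat \<Rightarrow> cp2_dual" where
  "standard t = (\<lambda>j\<in>{1..10}. proj (N t j))"

definition ratio :: "complex \<Rightarrow> (nat \<Rightarrow> cp2_dual) \<Rightarrow> bool" where
  "ratio t B \<longleftrightarrow> cross_ratio t (B a) (B b) (B c) (B d) (B l)"

text \<open>A zero vector would make every determinant through \<open>i\<close> vanish, but
  \<open>spanning\<close> provides a nonconcurrent triple.\<close>

lemma N_nonzero:
  assumes "golden t" "i \<in> {1..10}"
  shows "N t i \<noteq> 0"
proof
  assume 0: "N t i = 0"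
  obtain j :: nat where j: "j \<in> {1..10}" "j \<noteq> i"
    by (cases "i = 1") (auto intro: that[of 1] that[of 2])
  obtain k where k: "k \<in> {1..10} - {i, j}" "\<not> concurrent_triple C i j k"
    using spanning[OF assms(2) j(1)] j(2) by blast
  have "bracket (N t i) (N t j) (N t k) = 0" by (simp add: 0 bracket_def)
  then show False using N_bracket[OF assms(1,2) j(1), of k] k j(2) by blast
qed

text \<open>Distinctness again comes from \<open>spanning\<close>: two equal lines would be
  concurrent with every third.\<close>

lemma standard_realizes:
  assumes t: "golden t"
  shows "realizes 10 C (standard t)"
proof -
  have col: "concurrent (standard t i) (standard t j) (standard t k) \<longleftrightarrow> concurrent_triple C i j k"
    if "i \<in> {1..10}" "j \<in> {1..10}" "k \<in> {1..10}" "i \<noteq> j" "i \<noteq> k" "j \<noteq> k" for i j k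
    using that N_bracket[OF t that] N_nonzero[OF t] by (simp add: standard_def concurrent_proj)
  have "inj_on (standard t) {1..10}"
  proof (rule inj_onI, rule ccontr)
    fix i j assume ij: "i \<in> {1..10}" "j \<in> {1..10}" "standard t i = standard t j" "i \<noteq> j"
    obtain k where k: "k \<in> {1..10} - {i, j}" "\<not> concurrent_triple C i j k"
      using spanning[OF ij(1,2,4)] by blast
    have "concurrent (standard t i) (standard t j) (standard t k)" by (simp add: ij(3))
    then show False using col[OF ij(1,2), of k] ij(4) k by blast
  qed
  moreover have "standard t \<in> {1..10} \<rightarrow>\<^sub>E UNIV" by (simp add: standard_def)
  ultimately show ?thesis using col unfolding realizes_def arrangement_def by blast
qed

lemma standard_ratio:
  assumes t: "golden t"
  shows "ratio t (standard t)"
proof -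
  have mem: "a \<in> {1..10}" "b \<in> {1..10}" "c \<in> {1..10}" "d \<in> {1..10}" "l \<in> {1..10}"
    using idx by simp_all
  have "cross_ratio_vec t (N t a) (N t b) (N t c) (N t d) (N t l)"
    by (simp add: cross_ratio_vec_def bracket_def N_frame N_free)
  then show ?thesis
    unfolding ratio_def standard_def using mem
    by (simp only: restrict_apply if_True cross_ratio_proj[OF mem[THEN N_nonzero[OF t]]])
qed

lemma normalized_coordinates:
  assumes B: "realizes 10 C B"
  obtains B' v where "B' \<in> PGL_orbit 10 B" "\<And>j. j \<in> {1..10} \<Longrightarrow> v j \<noteq> 0 \<and> B' j = proj (v j)"
    "v a = vector [1, 0, 0]" "v b = vector [0, 1, 0]" "v c = vector [0, 0, 1]" "v d = vector [1, 1, 1]"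
proof -
  have mem: "a \<in> {1..10}" "b \<in> {1..10}" "c \<in> {1..10}" "d \<in> {1..10}"
    using idx by simp_all
  have ne: "a \<noteq> b" "a \<noteq> c" "a \<noteq> d" "b \<noteq> c" "b \<noteq> d" "c \<noteq> d" using frame_distinct by simp_all
  note col = realizes_concurrent[OF B]
  have "\<not> concurrent (B a) (B b) (B c)" "\<not> concurrent (B a) (B b) (B d)"
    "\<not> concurrent (B a) (B c) (B d)" "\<not> concurrent (B b) (B c) (B d)"
    using frame col mem ne by blast+
  then obtain M where M: "invertible M" "act M (B a) = proj (vector [1, 0, 0])"
    "act M (B b) = proj (vector [0, 1, 0])" "act M (B c) = proj (vector [0, 0, 1])"
    "act M (B d) = proj (vector [1, 1, 1])"
    by (rule projective_frame)
  define B' where "B' = (\<lambda>j\<in>{1..10}. act M (B j))"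
  \<comment> \<open>For the frame lines \<open>rep_cp2\<close> would give only multiples of the
    standard vectors, so the exact vectors are inserted by hand.\<close>
  define v :: "nat \<Rightarrow> complex^3" where "v j =
    (if j = a then vector [1, 0, 0] else if j = b then vector [0, 1, 0]
     else if j = c then vector [0, 0, 1] else if j = d then vector [1, 1, 1]
     else rep_cp2 (act M (B j)))" for j
  show ?thesis
  proof (rule that[of B' v])
    show "B' \<in> PGL_orbit 10 B"
      unfolding PGL_orbit_eq using M(1) by (auto simp: B'_def intro!: exI[of _ M])
    have e: "(vector [1, 0, 0] :: complex^3) \<noteq> 0" "(vector [0, 1, 0] :: complex^3) \<noteq> 0"
      "(vector [0, 0, 1] :: complex^3) \<noteq> 0" "(vector [1, 1, 1] :: complex^3) \<noteq> 0"
      by (simp_all add: vec_eq_iff forall_3)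
    show "v j \<noteq> 0 \<and> B' j = proj (v j)" if "j \<in> {1..10}" for j
      using that M e by (simp add: v_def B'_def)
    show "v a = vector [1, 0, 0]" "v b = vector [0, 1, 0]" "v c = vector [0, 0, 1]"
      "v d = vector [1, 1, 1]"
      using ne by (simp_all add: v_def)
  qed
qed

text \<open>After normalization \<open>golden_free\<close> identifies the free line with that of
  \<open>N t\<close>; being parallel to \<open>N t\<close> then spreads along the join steps to all
  ten lines.\<close>

lemma realization_in_standard_orbit:
  assumes B: "realizes 10 C B"
  shows "\<exists>t. golden t \<and> standard t \<in> PGL_orbit 10 B"
proof -
  obtain B' v where B': "B' \<in> PGL_orbit 10 B"
    and v: "\<And>j. j \<in> {1..10} \<Longrightarrow> v j \<noteq> 0 \<and> B' j = proj (v j)"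
    and fr: "v a = vector [1, 0, 0]" "v b = vector [0, 1, 0]" "v c = vector [0, 0, 1]"
      "v d = vector [1, 1, 1]"
    using normalized_coordinates[OF B] by blast
  have R: "realizes 10 C B'" by (rule realizes_orbit[OF B B'])
  have "bracket (v i) (v j) (v k) = 0 \<longleftrightarrow> concurrent_triple C i j k"
    if "i \<in> {1..10}" "j \<in> {1..10}" "k \<in> {1..10}" "i \<noteq> j" "i \<noteq> k" "j \<noteq> k" for i j k
    using realizes_concurrent[OF R that] v[OF that(1)] v[OF that(2)] v[OF that(3)]
    by (simp add: concurrent_proj)
  then have rv: "realizes_vec C v" using v unfolding realizes_vec_def by blast
  from golden_free[OF rv fr] obtain t where t: "golden t" "parallel (v l) (N t l)" by blast
  have par: "\<forall>j\<in>{1..10}. parallel (v j) (N t j)"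
  proof (rule rigid)
    show "parallel (v l) (N t l)" by (rule t(2))
    show "parallel (v a) (N t a)" "parallel (v b) (N t b)" "parallel (v c) (N t c)"
      "parallel (v d) (N t d)"
      by (simp_all add: fr N_frame parallel_refl)
    fix p q r s k
    assume step: "join_step C p q r s k"
      and P: "parallel (v p) (N t p)" "parallel (v q) (N t q)" "parallel (v r) (N t r)"
        "parallel (v s) (N t s)"
    show "parallel (v k) (N t k)"
    proof (rule join_step_parallel[OF rv step P])
      show "N t k \<noteq> 0" using step N_nonzero[OF t(1), of k] by (simp add: join_step_def)
      show "bracket (N t p) (N t q) (N t k) = 0" "bracket (N t r) (N t s) (N t k) = 0"
        using step N_bracket[OF t(1), of p q k] N_bracket[OF t(1), of r s k]
        by (auto simp: join_step_def)
    qed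
  qed
  have "B' j = standard t j" if j: "j \<in> {1..10}" for j
  proof -
    obtain k where "k \<noteq> 0" "v j = k *s N t j" using par j unfolding parallel_def by blast
    then have "proj (v j) = proj (N t j)" using proj_scale N_nonzero[OF t(1) j] by simp
    then show ?thesis using v[OF j] j by (simp add: standard_def)
  qed
  moreover have "B' \<in> {1..10} \<rightarrow>\<^sub>E UNIV" "standard t \<in> {1..10} \<rightarrow>\<^sub>E UNIV"
    using realizes_extensional[OF R] by (simp_all add: standard_def)
  ultimately have "B' = standard t" by (metis PiE_ext)
  then show ?thesis using t(1) B' by blast
qed

lemma ratio_orbit: "B' \<in> PGL_orbit 10 B \<Longrightarrow> ratio t B' \<longleftrightarrow> ratio t B"
  unfolding ratio_def by (rule cross_ratio_orbit[OF _ idx])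

lemma ratio_unique:
  assumes B: "realizes 10 C B" and r: "ratio s B" "ratio t B"
  shows "s = t"
proof (rule cross_ratio_unique)
  have mem: "a \<in> {1..10}" "b \<in> {1..10}" "c \<in> {1..10}" "d \<in> {1..10}" "l \<in> {1..10}"
    using idx by simp_all
  have ne: "a \<noteq> l" "a \<noteq> c" "l \<noteq> c" "b \<noteq> c" "b \<noteq> d" "c \<noteq> d" using frame_distinct by auto
  show "\<not> concurrent (B a) (B l) (B c)"
    using realizes_concurrent[OF B mem(1,5,3) ne(1,2,3)] frame by blast
  show "\<not> concurrent (B d) (B b) (B c)"
    using realizes_concurrent[OF B mem(2,3,4) ne(4,5,6)] frame concurrent_permute by blast
qed (use r in \<open>auto simp: ratio_def\<close>)

lemma realization_ratio:
  assumes B: "realizes 10 C B"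
  obtains t where "golden t" "ratio t B" "standard t \<in> PGL_orbit 10 B"
  using realization_in_standard_orbit[OF B] standard_ratio ratio_orbit by blast

text \<open>Both orbits contain the same standard realization.\<close>

lemma same_ratio_same_orbit:
  assumes B: "realizes 10 C B" "ratio t B" and B': "realizes 10 C B'" "ratio t B'"
  shows "B' \<in> PGL_orbit 10 B"
proof -
  obtain s where s: "golden s" "ratio s B" "standard s \<in> PGL_orbit 10 B"
    by (rule realization_ratio[OF B(1)])
  obtain s' where s': "golden s'" "ratio s' B'" "standard s' \<in> PGL_orbit 10 B'"
    by (rule realization_ratio[OF B'(1)])
  have "s = t" "s' = t" using ratio_unique B B' s(2) s'(2) by blast+
  then have "B' \<in> PGL_orbit 10 (standard s)"
    using PGL_orbit_sym[OF s'(3) realizes_extensional[OF B'(1)]] by simp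
  then show ?thesis using PGL_orbit_trans[OF s(3)] by blast
qed

section \<open>Relabelling, the automorphism and the two components\<close>

lemma realizes_permuted:
  assumes B: "realizes 10 C B"
  shows "realizes 10 C (B \<circ> \<tau>)"
proof -
  have mem: "\<tau> i \<in> {1..10} \<longleftrightarrow> i \<in> {1..10}" for i by (rule permutes_in_image[OF \<tau>(1)])
  have inj: "\<tau> i = \<tau> j \<longleftrightarrow> i = j" for i j using permutes_inj[OF \<tau>(1)] by (simp add: inj_eq)
  have "(B \<circ> \<tau>) i = undefined" if "i \<notin> {1..10}" for i
    using realizes_extensional[OF B] that mem[of i] by (auto simp: PiE_iff extensional_def)
  then have "B \<circ> \<tau> \<in> {1..10} \<rightarrow>\<^sub>E UNIV" by (auto simp: PiE_iff extensional_def)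
  moreover have "inj_on (B \<circ> \<tau>) {1..10}"
  proof (rule inj_onI)
    fix i j assume "i \<in> {1..10}" "j \<in> {1..10}" "(B \<circ> \<tau>) i = (B \<circ> \<tau>) j"
    then show "i = j" using realizes_distinct[OF B, of "\<tau> i" "\<tau> j"] mem inj by simp
  qed
  moreover have "concurrent ((B \<circ> \<tau>) i) ((B \<circ> \<tau>) j) ((B \<circ> \<tau>) k) = concurrent_triple C i j k"
    if "i \<in> {1..10}" "j \<in> {1..10}" "k \<in> {1..10}" "i \<noteq> j" "i \<noteq> k" "j \<noteq> k" for i j k
    using realizes_concurrent[OF B, of "\<tau> i" "\<tau> j" "\<tau> k"] that mem inj \<tau>_concurrent[of i j k]
    by simp
  ultimately show ?thesis unfolding realizes_def arrangement_def by blast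
qed

text \<open>The identity for the relabelled lines is assumed only for the standard coordinates;
  projective invariance of the cross ratio carries it to \<open>B\<close>.\<close>

lemma ratio_permuted:
  assumes B: "realizes 10 C B" and t: "ratio t B" "golden t"
  shows "ratio (1 - t) (B \<circ> \<tau>)"
proof -
  have mem: "\<tau> i \<in> {1..10}" if "i \<in> {a, b, c, d, l}" for i
    using permutes_in_image[OF \<tau>(1), of i] idx that by blast
  obtain s where s: "golden s" "ratio s B" "standard s \<in> PGL_orbit 10 B"
    by (rule realization_ratio[OF B])
  have st: "s = t" by (rule ratio_unique[OF B s(2) t(1)])
  have "cross_ratio (1 - t) (standard t (\<tau> a)) (standard t (\<tau> b)) (standard t (\<tau> c))
      (standard t (\<tau> d)) (standard t (\<tau> l))"
    using \<tau>_cross_ratio[OF t(2)] mem N_nonzero[OF t(2)] by (simp add: standard_def cross_ratio_proj)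
  moreover have "{\<tau> a, \<tau> b, \<tau> c, \<tau> d, \<tau> l} \<subseteq> {1..10}" using mem by blast
  ultimately show ?thesis
    using cross_ratio_orbit[OF s(3)] unfolding st ratio_def by simp
qed

lemma existence: "\<exists>A. arrangement 10 A \<and> has_combinatorics 10 C A"
proof -
  obtain t where "golden t" using golden_exists by blast
  then have R: "realizes 10 C (standard t)" by (rule standard_realizes)
  then have "has_combinatorics 10 C (standard t)"
    by (rule realizes_imp_has_combinatorics[OF _ blocks linear])
  then show ?thesis using R unfolding realizes_def by blast
qed

lemma automorphism:
  assumes A: "realizes 10 C A"
  shows "\<exists>H. subgroup H (Aut 10 A) \<and> (Aut 10 A)\<lparr>carrier := H\<rparr> \<cong> integer_mod_group 2"
proof -
  let ?G = "Aut 10 A"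
  interpret G: group ?G by (rule group_Aut)
  have one: "\<one>\<^bsub>?G\<^esub> = id" and mult: "x \<otimes>\<^bsub>?G\<^esub> y = x \<circ> y" for x y
    by (simp_all add: Aut_def sym_group_def)
  have "\<tau> \<in> carrier ?G"
    using realizes_imp_identical_lattices[OF realizes_permuted[OF A] A] \<tau>(1) by (simp add: Aut_def)
  moreover have "inv\<^bsub>?G\<^esub> \<tau> = \<tau>"
    using calculation \<tau>(2) by (intro G.inv_equality) (simp_all add: one mult)
  ultimately have H: "subgroup {\<one>\<^bsub>?G\<^esub>, \<tau>} ?G"
    using \<tau>(2) by (intro G.subgroupI) (auto simp: one[symmetric] mult[symmetric])
  have "?G\<lparr>carrier := {\<one>\<^bsub>?G\<^esub>, \<tau>}\<rparr> \<cong> integer_mod_group 2"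
    by (rule iso_integer_mod_group_2[OF H _ _ group_Aut]) (use \<tau>(2,3) in \<open>simp_all add: one mult\<close>)
  then show ?thesis using H by blast
qed

text \<open>The given \<open>A\<close> represents one component, whichever root belongs to it; its
  swapped relabelling \<open>B\<close> has the conjugate ratio and represents the other.\<close>

lemma components:
  assumes A: "realizes 10 C A"
  shows "card (connected_components_of (moduli_space 10 A)) = 2"
    and "\<exists>Cp Cm Ap Am. connected_components_of (moduli_space 10 A) = {Cp, Cm} \<and> Cp \<noteq> Cm \<and>
         Ap \<in> realizations 10 A \<and> PGL_orbit 10 Ap \<in> Cp \<and>
         Am \<in> realizations 10 A \<and> PGL_orbit 10 Am \<in> Cm \<and>
         (\<exists>\<psi>. homeomorphism (complement 10 Ap) (complement 10 Am) swap_xy \<psi>)"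
proof -
  obtain t where t: "golden t" "ratio t A" by (rule realization_ratio[OF A])
  define B where "B = (\<lambda>j\<in>{1..10}. act swap_matrix ((A \<circ> \<tau>) j))"
  have orb: "B \<in> PGL_orbit 10 (A \<circ> \<tau>)"
    unfolding PGL_orbit_eq using invertible_swap_matrix
    by (auto simp: B_def intro!: exI[of _ swap_matrix])
  have B: "realizes 10 C B" by (rule realizes_orbit[OF realizes_permuted[OF A] orb])
  have tB: "ratio (1 - t) B" using ratio_permuted[OF A t(2,1)] ratio_orbit[OF orb] by simp
  have cover: "ratio t D \<noteq> ratio (1 - t) D" if D: "realizes 10 C D" for D
  proof -
    obtain s where s: "golden s" "ratio s D" by (rule realization_ratio[OF D])
    have "s = t \<or> s = 1 - t" by (rule golden_cases[OF t(1) s(1)])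
    moreover have "\<not> (ratio t D \<and> ratio (1 - t) D)"
      using ratio_unique[OF D] golden_neq_conjugate[OF t(1)] by metis
    ultimately show ?thesis using s(2) by blast
  qed
  have disc: "moduli_space 10 A = discrete_topology {PGL_orbit 10 A, PGL_orbit 10 B}"
    and ne: "PGL_orbit 10 A \<noteq> PGL_orbit 10 B"
    using moduli_space_two_points[OF idx A, of t "1 - t" A B] cover same_ratio_same_orbit A B t(2) tB
    unfolding ratio_def by blast+
  have comp: "connected_components_of (moduli_space 10 A) = {{PGL_orbit 10 A}, {PGL_orbit 10 B}}"
    unfolding disc connected_components_of_discrete_topology by simp
  show "card (connected_components_of (moduli_space 10 A)) = 2"
    unfolding comp using ne by simp
  have mem: "A \<in> realizations 10 A" "B \<in> realizations 10 A"
    using A B by (simp_all add: realizations_eq[OF A])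
  show "\<exists>Cp Cm Ap Am. connected_components_of (moduli_space 10 A) = {Cp, Cm} \<and> Cp \<noteq> Cm \<and>
         Ap \<in> realizations 10 A \<and> PGL_orbit 10 Ap \<in> Cp \<and>
         Am \<in> realizations 10 A \<and> PGL_orbit 10 Am \<in> Cm \<and>
         (\<exists>\<psi>. homeomorphism (complement 10 Ap) (complement 10 Am) swap_xy \<psi>)"
  proof (intro exI conjI)
    show "connected_components_of (moduli_space 10 A) = {{PGL_orbit 10 A}, {PGL_orbit 10 B}}"
      by (rule comp)
    show "{PGL_orbit 10 A} \<noteq> {PGL_orbit 10 B}" using ne by simp
    show "homeomorphism (complement 10 A) (complement 10 B) swap_xy swap_xy"
      by (rule homeomorphism_complement_swap[OF \<tau>(1)]) (simp add: B_def)
  qed (simp_all add: mem)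
qed

end

section \<open>Certificates over the golden integers\<close>

text \<open>The pair \<open>(m, n)\<close> stands for \<open>m + n t\<close>, where \<open>t\<^sup>2 = t + 1\<close>.\<close>

type_synonym golden_int = "int \<times> int"

fun ev :: "complex \<Rightarrow> golden_int \<Rightarrow> complex" where
  "ev t (m, n) = of_int m + of_int n * t"

fun gadd :: "golden_int \<Rightarrow> golden_int \<Rightarrow> golden_int" where
  "gadd (m, n) (m', n') = (m + m', n + n')"

fun gsub :: "golden_int \<Rightarrow> golden_int \<Rightarrow> golden_int" where
  "gsub (m, n) (m', n') = (m - m', n - n')"

fun gmul :: "golden_int \<Rightarrow> golden_int \<Rightarrow> golden_int" where
  "gmul (m, n) (m', n') = (m * m' + n * n', m * n' + n * m' + n * n')"

text \<open>The norm: the product of m + n t and its conjugate m + n (1 - t).\<close>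

fun gnorm :: "golden_int \<Rightarrow> int" where
  "gnorm (m, n) = m * m + m * n - n * n"

fun gbracket :: "golden_int \<times> golden_int \<times> golden_int \<Rightarrow> golden_int \<times> golden_int \<times> golden_int \<Rightarrow>
    golden_int \<times> golden_int \<times> golden_int \<Rightarrow> golden_int" where
  "gbracket (u1, u2, u3) (v1, v2, v3) (w1, w2, w3) =
    gadd (gsub (gmul u1 (gsub (gmul v2 w3) (gmul v3 w2))) (gmul u2 (gsub (gmul v1 w3) (gmul v3 w1))))
      (gmul u3 (gsub (gmul v1 w2) (gmul v2 w1)))"

fun gvec :: "complex \<Rightarrow> golden_int \<times> golden_int \<times> golden_int \<Rightarrow> complex^3" where
  "gvec t (x, y, z) = vector [ev t x, ev t y, ev t z]"

lemma ev_gadd: "ev t (gadd p q) = ev t p + ev t q"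
  by (cases p; cases q) (simp add: algebra_simps)

lemma ev_gsub: "ev t (gsub p q) = ev t p - ev t q"
  by (cases p; cases q) (simp add: algebra_simps)

lemma ev_gmul:
  assumes "golden t"
  shows "ev t (gmul p q) = ev t p * ev t q"
proof -
  obtain m n m' n' where pq: "p = (m, n)" "q = (m', n')" by fastforce
  have "ev t p * ev t q = of_int (m * m') + of_int (m * n' + n * m') * t + of_int (n * n') * (t * t)"
    by (simp add: pq algebra_simps)
  also have "\<dots> = ev t (gmul p q)"
    using assms by (simp add: pq golden_def algebra_simps)
  finally show ?thesis ..
qed

text \<open>Multiplying by the value at the other root gives the integer norm, so a nonzero norm
  excludes a zero at either root.\<close>

lemma ev_nonzero:
  assumes t: "golden t" and p: "gnorm p \<noteq> 0"
  shows "ev t p \<noteq> 0"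
proof
  obtain m n where mn: "p = (m, n)" by fastforce
  assume "ev t p = 0"
  moreover have "ev t p * ev (1 - t) p
      = of_int (m * m + m * n) + of_int (n * n) * (t - t * t)"
    by (simp add: mn algebra_simps)
  ultimately have "of_int (m * m + m * n) - of_int (n * n) = (0 :: complex)"
    using t by (simp add: golden_def)
  then have "(of_int (m * m + m * n - n * n) :: complex) = 0" by simp
  then show False using p unfolding of_int_eq_0_iff by (simp add: mn)
qed

lemma bracket_gvec:
  "golden t \<Longrightarrow> bracket (gvec t u) (gvec t v) (gvec t w) = ev t (gbracket u v w)"
  by (cases u; cases v; cases w) (simp add: bracket_def ev_gadd ev_gsub ev_gmul)

text \<open>Blocks are kept as lists so that the checks below evaluate quickly.\<close>

definition block_sets :: "nat list list \<Rightarrow> nat set set" where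
  "block_sets bs = set (map set bs)"

definition concurrent_list :: "nat list list \<Rightarrow> nat \<Rightarrow> nat \<Rightarrow> nat \<Rightarrow> bool" where
  "concurrent_list bs i j k \<longleftrightarrow> (\<exists>X\<in>set bs. i \<in> set X \<and> j \<in> set X \<and> k \<in> set X)"

lemma concurrent_triple_block_sets:
  "concurrent_triple (block_sets bs) i j k \<longleftrightarrow> concurrent_list bs i j k"
  by (auto simp: concurrent_triple_def concurrent_list_def block_sets_def)

text \<open>The determinant is alternating, so increasing triples suffice. Lists start at position 0
  and labels at 1, hence the shifts.\<close>

definition certifies_brackets ::
  "nat list list \<Rightarrow> (golden_int \<times> golden_int \<times> golden_int) list \<Rightarrow> bool" where
  "certifies_brackets bs Ls \<longleftrightarrow>
    (\<forall>i\<in>set [1..<11]. \<forall>j\<in>set [Suc i..<11]. \<forall>k\<in>set [Suc j..<11].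
      let p = gbracket (Ls ! (i - 1)) (Ls ! (j - 1)) (Ls ! (k - 1)) in
      if concurrent_list bs i j k then p = (0, 0) else gnorm p \<noteq> 0)"

text \<open>The bound \<open>length X < 10\<close> says that not all lines pass through one point;
  \<open>spanning\<close> is derived from it.\<close>

definition certifies_combinatorics :: "nat list list \<Rightarrow> bool" where
  "certifies_combinatorics bs \<longleftrightarrow>
    (\<forall>X\<in>set bs. distinct X \<and> 3 \<le> length X \<and> length X < 10 \<and> (\<forall>i\<in>set X. 1 \<le> i \<and> i \<le> 10)) \<and>
    (\<forall>X\<in>set bs. \<forall>Y\<in>set bs. X = Y \<or> length (filter (\<lambda>i. i \<in> set Y) X) \<le> 1)"

definition certifies_symmetry :: "nat list list \<Rightarrow> nat list \<Rightarrow> bool" where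
  "certifies_symmetry bs ts \<longleftrightarrow>
    (\<forall>j\<in>set [1..<11]. 1 \<le> ts ! (j - 1) \<and> ts ! (j - 1) \<le> 10 \<and> ts ! (ts ! (j - 1) - 1) = j) \<and>
    ts ! 1 \<noteq> 2 \<and>
    (\<forall>X\<in>set bs. \<exists>Y\<in>set bs. \<forall>j\<in>set X. ts ! (j - 1) \<in> set Y)"

text \<open>\<open>J\<close> holds the lines recovered so far; every step may use only
  these.\<close>

fun closure_steps :: "nat set set \<Rightarrow> nat set \<Rightarrow> (nat \<times> nat \<times> nat \<times> nat \<times> nat) list \<Rightarrow> bool" where
  "closure_steps C J [] \<longleftrightarrow> {1..10} \<subseteq> J"
| "closure_steps C J ((p, q, r, s, k) # xs) \<longleftrightarrow>
    {p, q, r, s} \<subseteq> J \<and> join_step C p q r s k \<and> closure_steps C (insert k J) xs"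

lemma closure_steps_induct:
  assumes "closure_steps C J xs" "\<forall>j\<in>J. P j"
    and step: "\<And>p q r s k. join_step C p q r s k \<Longrightarrow> P p \<Longrightarrow> P q \<Longrightarrow> P r \<Longrightarrow> P s \<Longrightarrow> P k"
  shows "\<forall>j\<in>{1..10}. P j"
  using assms(1,2)
proof (induction xs arbitrary: J)
  case Nil
  then show ?case by auto
next
  case (Cons x xs)
  obtain p q r s k where x: "x = (p, q, r, s, k)" by (metis surj_pair)
  have J: "{p, q, r, s} \<subseteq> J" "\<forall>j\<in>J. P j" and k: "join_step C p q r s k"
    and rest: "closure_steps C (insert k J) xs" using Cons.prems by (simp_all add: x)
  have "P k" by (rule step[OF k]) (use J in blast)+
  then show ?case using Cons.IH[OF rest] J(2) by blast
qed

text \<open>The two adjacent transpositions generate all six orders.\<close>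

lemma distinct_triple_wlog:
  fixes i j k :: nat
  assumes sym: "\<And>i j k. Q i j k \<Longrightarrow> Q j i k" "\<And>i j k. Q i j k \<Longrightarrow> Q i k j"
    and sorted: "\<And>i j k. i \<in> S \<Longrightarrow> j \<in> S \<Longrightarrow> k \<in> S \<Longrightarrow> i < j \<Longrightarrow> j < k \<Longrightarrow> Q i j k"
    and ijk: "i \<in> S" "j \<in> S" "k \<in> S" "i \<noteq> j" "i \<noteq> k" "j \<noteq> k"
  shows "Q i j k"
proof -
  consider "i < j" "j < k" | "i < k" "k < j" | "j < i" "i < k" | "j < k" "k < i" | "k < i" "i < j" | "k < j" "j < i"
    using ijk by linarith
  then show ?thesis by cases (use sorted sym ijk in metis)+
qed

text \<open>Leaves finite checks and a single algebraic task, \<open>golden\<close>, for each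
  combinatorics. In \<open>cr\<close> the pair (1, -1) stands for 1 - t. The third coordinate
  \<open>z\<close> of the free line differs between the cases, and \<open>\<tau>\<close> is the
  identity off the labels because \<open>permutes\<close> demands it.\<close>

lemma golden_combinatoricsI:
  fixes bs Ls ts steps a b c d l
  defines "C \<equiv> block_sets bs" and "N \<equiv> \<lambda>t j. gvec t (Ls ! (j - 1))" and "\<tau> \<equiv> \<lambda>j. if j \<in> {1..10} then ts ! (j - 1) else j"
  assumes brackets: "certifies_brackets bs Ls" and comb: "certifies_combinatorics bs"
    and symm: "certifies_symmetry bs ts" and steps: "closure_steps C {a, b, c, d, l} steps"
    and idx: "{a, b, c, d, l} \<subseteq> {1..10}" "distinct [a, b, c, d, l]"
    and frame: "\<not> concurrent_triple C a b c" "\<not> concurrent_triple C a b d"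
      "\<not> concurrent_triple C a c d" "\<not> concurrent_triple C b c d" "\<not> concurrent_triple C a l c"
    and Ls: "Ls ! (a - 1) = ((1, 0), (0, 0), (0, 0))" "Ls ! (b - 1) = ((0, 0), (1, 0), (0, 0))"
      "Ls ! (c - 1) = ((0, 0), (0, 0), (1, 0))" "Ls ! (d - 1) = ((1, 0), (1, 0), (1, 0))"
      "Ls ! (l - 1) = ((0, 1), (1, 0), z)"
    and cr: "let V = (\<lambda>j. Ls ! (ts ! (j - 1) - 1)) in
      gmul (gbracket (V l) (V b) (V c)) (gbracket (V a) (V d) (V c)) =
      gmul (1, -1) (gmul (gbracket (V a) (V l) (V c)) (gbracket (V d) (V b) (V c)))"
    and golden: "\<And>v. realizes_vec C v \<Longrightarrow> v a = vector [1, 0, 0] \<Longrightarrow>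
      v b = vector [0, 1, 0] \<Longrightarrow> v c = vector [0, 0, 1] \<Longrightarrow> v d = vector [1, 1, 1] \<Longrightarrow>
      \<exists>t. golden t \<and> parallel (v l) (gvec t ((0, 1), (1, 0), z))"
  shows "golden_combinatorics C a b c d l N \<tau>"
proof
  have range: "set [1..<11] = {1..10 :: nat}" by auto
  note conc = concurrent_triple_block_sets[of bs, folded C_def]
  note comb' = comb[unfolded certifies_combinatorics_def]
  note symm' = symm[unfolded certifies_symmetry_def range]
  have blocks: "X \<subseteq> {1..10} \<and> 3 \<le> card X \<and> card X < 10" if X: "X \<in> C" for X
  proof -
    obtain Y where Y: "Y \<in> set bs" "X = set Y" using X unfolding C_def block_sets_def by auto
    from bspec[OF comb'[THEN conjunct1] Y(1)] show ?thesis
      by (auto simp: Y(2) distinct_card)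
  qed
  have linear: "X = Y" if X: "X \<in> C" "Y \<in> C" "i \<in> X \<inter> Y" "j \<in> X \<inter> Y" "i \<noteq> j" for X Y i j
  proof (rule ccontr)
    assume "X \<noteq> Y"
    moreover obtain X' Y' where XY: "X' \<in> set bs" "X = set X'" "Y' \<in> set bs" "Y = set Y'"
      using X(1,2) unfolding C_def block_sets_def by auto
    ultimately have len: "length (filter (\<lambda>i. i \<in> set Y') X') \<le> 1"
      using bspec[OF bspec[OF comb'[THEN conjunct2] XY(1)] XY(3)] by auto
    have "card (X \<inter> Y) \<le> length (filter (\<lambda>i. i \<in> set Y') X')"
      using card_length[of "filter (\<lambda>i. i \<in> set Y') X'"] by (simp add: XY Int_def)
    moreover have "card {i, j} \<le> card (X \<inter> Y)" by (rule card_mono) (use X XY in auto)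
    ultimately show False using len X(5) by simp
  qed
  have \<tau>_in: "\<tau> j \<in> {1..10}" "\<tau> (\<tau> j) = j" if "j \<in> {1..10}" for j
    using bspec[OF symm'[THEN conjunct1] that] that by (simp_all add: \<tau>_def)
  have \<tau>\<tau>: "\<tau> (\<tau> j) = j" for j
  proof (cases "j \<in> {1..10}")
    case True
    then show ?thesis by (rule \<tau>_in(2))
  next
    case False
    then have "\<tau> j = j" by (simp only: \<tau>_def if_False)
    then show ?thesis by simp
  qed
  show "\<tau> \<circ> \<tau> = id" using \<tau>\<tau> by (simp add: fun_eq_iff)
  show "\<tau> permutes {1..10}"
    unfolding permutes_def
  proof (intro conjI allI impI)
    show "\<tau> j = j" if "j \<notin> {1..10}" for j using that by (simp only: \<tau>_def if_False)
    show "\<exists>!i. \<tau> i = j" for j using \<tau>\<tau> by metis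
  qed
  have "\<tau> 2 \<noteq> 2" using symm by (simp add: certifies_symmetry_def \<tau>_def)
  then show "\<tau> \<noteq> id" by auto
  have imp: "concurrent_triple C (\<tau> i) (\<tau> j) (\<tau> k)" if ijk: "concurrent_triple C i j k" for i j k
  proof -
    obtain X where X: "X \<in> set bs" "i \<in> set X" "j \<in> set X" "k \<in> set X"
      using ijk unfolding conc concurrent_list_def by blast
    from bspec[OF symm'[THEN conjunct2, THEN conjunct2] X(1)]
    obtain Y where Y: "Y \<in> set bs" "\<forall>j\<in>set X. ts ! (j - 1) \<in> set Y" ..
    have "\<tau> m = ts ! (m - 1)" if "m \<in> set X" for m
    proof -
      have "1 \<le> m \<and> m \<le> 10" using bspec[OF comb'[THEN conjunct1] X(1)] that by blast
      then show ?thesis by (simp add: \<tau>_def)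
    qed
    then have "\<tau> i \<in> set Y" "\<tau> j \<in> set Y" "\<tau> k \<in> set Y" using Y(2) X(2-4) by auto
    then show ?thesis unfolding conc concurrent_list_def using Y(1) by blast
  qed
  show "concurrent_triple C (\<tau> i) (\<tau> j) (\<tau> k) \<longleftrightarrow> concurrent_triple C i j k" for i j k
    using imp[of i j k] imp[of "\<tau> i" "\<tau> j" "\<tau> k"] unfolding \<tau>\<tau> by (rule iffI[rotated])
  show "cross_ratio_vec (1 - t) (N t (\<tau> a)) (N t (\<tau> b)) (N t (\<tau> c)) (N t (\<tau> d)) (N t (\<tau> l))"
    if t: "golden t" for t
  proof -
    define V where "V j = Ls ! (ts ! (j - 1) - 1)" for j
    have V: "N t (\<tau> j) = gvec t (V j)" if "j \<in> {a, b, c, d, l}" for j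
    proof -
      have "j \<in> {1..10}" using idx(1) that by blast
      then show ?thesis by (simp only: N_def \<tau>_def V_def if_True)
    qed
    have e: "ev t (1, - 1) = 1 - t" by simp
    have "gmul (gbracket (V l) (V b) (V c)) (gbracket (V a) (V d) (V c)) =
      gmul (1, - 1) (gmul (gbracket (V a) (V l) (V c)) (gbracket (V d) (V b) (V c)))"
      using cr unfolding Let_def V_def .
    from arg_cong[OF this, of "ev t"] show ?thesis
      unfolding cross_ratio_vec_def by (simp only: V insert_iff simp_thms bracket_gvec[OF t] ev_gmul[OF t] e)
  qed
  show "bracket (N t i) (N t j) (N t k) = 0 \<longleftrightarrow> concurrent_triple C i j k"
    if t: "golden t" and ijk: "i \<in> {1..10}" "j \<in> {1..10}" "k \<in> {1..10}" "i \<noteq> j" "i \<noteq> k" "j \<noteq> k" for t i j k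
  proof (rule distinct_triple_wlog[where S = "{1..10}", OF _ _ _ ijk])
    fix i j k
    show "bracket (N t i) (N t j) (N t k) = 0 \<longleftrightarrow> concurrent_triple C i j k \<Longrightarrow>
      bracket (N t j) (N t i) (N t k) = 0 \<longleftrightarrow> concurrent_triple C j i k"
      using bracket_permute(1)[of "N t j" "N t i" "N t k"]
      by (simp add: concurrent_triple_def conj_ac)
    show "bracket (N t i) (N t j) (N t k) = 0 \<longleftrightarrow> concurrent_triple C i j k \<Longrightarrow>
      bracket (N t i) (N t k) (N t j) = 0 \<longleftrightarrow> concurrent_triple C i k j"
      using bracket_permute(2)[of "N t i" "N t k" "N t j"]
      by (simp add: concurrent_triple_def conj_ac)
  next
    fix i j k :: nat assume "i \<in> {1..10}" "j \<in> {1..10}" "k \<in> {1..10}" "i < j" "j < k"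
    then have ijk: "i \<in> set [1..<11]" "j \<in> set [Suc i..<11]" "k \<in> set [Suc j..<11]" by auto
    define p where "p = gbracket (Ls ! (i - 1)) (Ls ! (j - 1)) (Ls ! (k - 1))"
    have "if concurrent_triple C i j k then p = (0, 0) else gnorm p \<noteq> 0"
      unfolding p_def conc by (rule brackets[unfolded certifies_brackets_def Let_def, rule_format, OF ijk])
    then show "bracket (N t i) (N t j) (N t k) = 0 \<longleftrightarrow> concurrent_triple C i j k"
      unfolding N_def bracket_gvec[OF t] p_def[symmetric]
      using ev_nonzero[OF t, of p] by (auto split: if_splits)
  qed
  show "X \<subseteq> {1..10} \<and> 3 \<le> card X" if "X \<in> C" for X
    using blocks[OF that] by blast
  show "X = Y" if "X \<in> C" "Y \<in> C" "i \<in> X \<inter> Y" "j \<in> X \<inter> Y" "i \<noteq> j" for X Y i j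
    by (rule linear[OF that])
  show "\<exists>k\<in>{1..10} - {i, j}. \<not> concurrent_triple C i j k"
    if ij: "i \<in> {1..10}" "j \<in> {1..10}" "i \<noteq> j" for i j
  proof (rule ccontr)
    \<comment> \<open>If every other line passed through the meet of \<open>i\<close> and
      \<open>j\<close>, then by \<open>linear\<close> a single block would contain all ten
      labels.\<close>
    assume neg: "\<not> (\<exists>k\<in>{1..10} - {i, j}. \<not> concurrent_triple C i j k)"
    have all: "\<exists>X\<in>C. i \<in> X \<and> j \<in> X \<and> k \<in> X" if k: "k \<in> {1..10} - {i, j}" for k
    proof -
      have "concurrent_triple C i j k" using neg k by blast
      then show ?thesis by (simp add: concurrent_triple_def)
    qed
    have "\<not> {1..10} \<subseteq> {i, j}"
    proof
      assume "{1..10} \<subseteq> {i, j}"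
      then have "card {1..10 :: nat} \<le> card {i, j}" by (intro card_mono) auto
      then show False using ij(3) by simp
    qed
    then obtain k where "k \<in> {1..10} - {i, j}" by blast
    then obtain X where X: "X \<in> C" "i \<in> X" "j \<in> X" using all by blast
    have "m \<in> X" if m: "m \<in> {1..10}" for m
    proof (cases "m \<in> {i, j}")
      case False
      then obtain Y where "Y \<in> C" "i \<in> Y" "j \<in> Y" "m \<in> Y" using all m by blast
      then show ?thesis using linear[OF X(1), of Y i j] X(2,3) ij(3) by blast
    qed (use X in blast)
    then have "X = {1..10}" using blocks[OF X(1)] by blast
    then show False using blocks[OF X(1)] by simp
  qed
  show "\<forall>j\<in>{1..10}. P j"
    if "P a" "P b" "P c" "P d" "P l"
      "\<And>p q r s k. join_step C p q r s k \<Longrightarrow> P p \<Longrightarrow> P q \<Longrightarrow> P r \<Longrightarrow> P s \<Longrightarrow> P k" for P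
    by (rule closure_steps_induct[OF steps]) (use that in blast)+
  show "N t a = vector [1, 0, 0]" "N t b = vector [0, 1, 0]" "N t c = vector [0, 0, 1]"
    "N t d = vector [1, 1, 1]" "N t l $ 1 = t" "N t l $ 2 = 1" for t
    by (simp_all add: N_def Ls[unfolded One_nat_def])
  show "\<exists>t. golden t \<and> parallel (v l) (N t l)"
    if "realizes_vec C v" "v a = vector [1, 0, 0]" "v b = vector [0, 1, 0]" "v c = vector [0, 0, 1]"
      "v d = vector [1, 1, 1]" for v
    unfolding N_def Ls(5) by (rule golden[OF that])
qed (use idx frame in simp_all)

section \<open>The three combinatorics\<close>

definition blocks1 :: "nat list list" where
  "blocks1 = [[1, 2, 3, 10], [4, 5, 6, 10], [7, 8, 10], [3, 4, 9], [5, 7, 9], [2, 6, 7],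
    [2, 8, 9], [3, 6, 8], [1, 5, 8], [1, 4, 7]]"

lemma combinatorics_1: "combinatorics 1 = block_sets blocks1"
  by (simp add: combinatorics_def block_sets_def blocks1_def)

definition blocks6 :: "nat list list" where
  "blocks6 = [[1, 2, 3], [1, 4, 7], [1, 6, 9], [2, 4, 8], [2, 5, 7], [3, 5, 9],
    [3, 6, 8], [4, 5, 6], [7, 8, 9], [4, 9, 10], [3, 7, 10], [1, 5, 10]]"

lemma combinatorics_6: "combinatorics 6 = block_sets blocks6"
  by (simp add: combinatorics_def block_sets_def blocks6_def)

definition blocks7 :: "nat list list" where
  "blocks7 = [[1, 2, 3], [1, 4, 7], [1, 6, 9], [2, 4, 8], [2, 5, 7], [3, 5, 9],
    [3, 6, 8], [4, 5, 6], [7, 8, 9], [3, 4, 10], [6, 7, 10], [2, 9, 10]]"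

lemma combinatorics_7: "combinatorics 7 = block_sets blocks7"
  by (simp add: combinatorics_def block_sets_def blocks7_def)

text \<open>
  The entry for a line holds its dual coordinates. The frames are \<open>(1, 5, 4, 9)\<close>, \<open>(5, 3, 2, 10)\<close>
  and \<open>(2, 4, 1, 6)\<close>; the free lines are \<open>8\<close>, \<open>9\<close> and \<open>10\<close>.
\<close>

definition coords1 :: "(golden_int \<times> golden_int \<times> golden_int) list" where
  "coords1 = [((1, 0), (0, 0), (0, 0)),
    ((1, 1), (1, 0), (0, -1)),
    ((1, 0), (1, 0), (0, -1)),
    ((0, 0), (0, 0), (1, 0)),
    ((0, 0), (1, 0), (0, 0)),
    ((0, 0), (1, 0), (-1, -2)),
    ((1, 0), (0, 0), (1, 0)),
    ((0, 1), (1, 0), (0, 0)),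
    ((1, 0), (1, 0), (1, 0)),
    ((0, 0), (-1, 0), (0, 1))]"

definition coords6 :: "(golden_int \<times> golden_int \<times> golden_int) list" where
  "coords6 = [((0, 0), (1, 0), (1, 0)),
    ((0, 0), (0, 0), (1, 0)),
    ((0, 0), (1, 0), (0, 0)),
    ((1, 0), (0, 1), (1, 1)),
    ((1, 0), (0, 0), (0, 0)),
    ((0, -1), (0, 1), (1, 1)),
    ((1, 0), (0, 0), (1, 0)),
    ((0, 1), (1, 1), (-1, -1)),
    ((0, 1), (1, 0), (0, 0)),
    ((1, 0), (1, 0), (1, 0))]"

definition coords7 :: "(golden_int \<times> golden_int \<times> golden_int) list" where
  "coords7 = [((0, 0), (0, 0), (1, 0)),
    ((1, 0), (0, 0), (0, 0)),
    ((1, 0), (0, 0), (0, 1)),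
    ((0, 0), (1, 0), (0, 0)),
    ((1, 0), (1, -1), (1, 0)),
    ((1, 0), (1, 0), (1, 0)),
    ((0, 0), (-1, 1), (-1, 0)),
    ((1, 0), (1, 1), (0, 0)),
    ((1, 0), (1, 0), (1, 1)),
    ((0, 1), (1, 0), (1, 1))]"

section \<open>The golden equation for the first combinatorics\<close>

lemma steps_1: "closure_steps (combinatorics 1) {1, 5, 4, 9, 8} [(5, 9, 1, 4, 7), (7, 8, 4, 5, 10), (8, 9, 1, 10, 2), (2, 10, 4, 9, 3), (4, 5, 2, 7, 6)]"
  by code_simp

lemma golden_1:
  assumes v: "realizes_vec (combinatorics 1) v" and frame: "v 1 = vector [1, 0, 0]" "v 5 = vector [0, 1, 0]"
    "v 4 = vector [0, 0, 1]" "v 9 = vector [1, 1, 1]"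
  shows "\<exists>t. golden t \<and> parallel (v 8) (gvec t ((0, 1), (1, 0), (0, 0)))"
proof -
  \<comment> \<open>Besides driving the closure, the certified steps supply the
    \<open>join_step\<close> facts for the explicit vectors below.\<close>
  note steps = steps_1[unfolded closure_steps.simps]
  have conc: "bracket (v i) (v j) (v k) = 0" if "concurrent_triple (combinatorics 1) i j k"
      "{i, j, k} \<subseteq> {1..10}" "distinct [i, j, k]" for i j k
    using realizes_vec_bracket[OF v that(2,3)] that(1) by blast
  have nconc: "bracket (v i) (v j) (v k) \<noteq> 0" if "\<not> concurrent_triple (combinatorics 1) i j k"
      "{i, j, k} \<subseteq> {1..10}" "distinct [i, j, k]" for i j k
    using realizes_vec_bracket[OF v that(2,3)] that(1) by blast
  obtain x y z where xyz: "v 8 = vector [x, y, z]"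
    using that[of "v 8 $ 1" "v 8 $ 2" "v 8 $ 3"] by (simp add: vec_eq_iff forall_3)
  have ny: "bracket (v 1) (v 4) (v 8) \<noteq> 0" by (rule nconc, code_simp, simp, simp)
  then have y: "y \<noteq> 0" unfolding frame xyz by (simp add: bracket_def)
  have cz: "bracket (v 1) (v 5) (v 8) = 0" by (rule conc, code_simp, simp, simp)
  then have z: "z = 0" unfolding frame xyz by (simp add: bracket_def)
  define t where "t = x / y"
  have v8: "parallel (v 8) (vector [t, 1, 0])"
    unfolding parallel_def xyz using y by (intro exI[of _ y]) (simp add: vec_eq_iff forall_3 t_def z)
  have v1: "parallel (v 1) (vector [1, 0, 0])"
    and v5: "parallel (v 5) (vector [0, 1, 0])"
    and v4: "parallel (v 4) (vector [0, 0, 1])"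
    and v9: "parallel (v 9) (vector [1, 1, 1])"
    unfolding frame by (rule parallel_refl)+
  \<comment> \<open>The equation left over has the spurious factor \<open>t\<close>; it is excluded
    because 4, 5, 8 are not concurrent.\<close>
  have nt0: "bracket (v 5) (v 4) (v 8) \<noteq> 0" by (rule nconc, code_simp, simp, simp)
  then have t0: "t \<noteq> 0"
    unfolding parallel_bracket[OF v5 v4 v8] by (simp add: bracket_def)
  have v7: "parallel (v 7) (vector [1, 0, 1])"
    by (rule join_step_parallel[OF v _ v5 v9 v1 v4])
      (use steps  in \<open>auto simp: bracket_def vec_eq_iff forall_3 algebra_simps\<close>)
  have v10: "parallel (v 10) (vector [0, - 1, t])"
    by (rule join_step_parallel[OF v _ v7 v8 v4 v5])
      (use steps  in \<open>auto simp: bracket_def vec_eq_iff forall_3 algebra_simps\<close>)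
  have v2: "parallel (v 2) (vector [t * t, 1, - t])"
    by (rule join_step_parallel[OF v _ v8 v9 v1 v10])
      (use steps  in \<open>auto simp: bracket_def vec_eq_iff forall_3 algebra_simps\<close>)
  have v3: "parallel (v 3) (vector [1, 1, - t])"
    by (rule join_step_parallel[OF v _ v2 v10 v4 v9])
      (use steps  in \<open>auto simp: bracket_def vec_eq_iff forall_3 algebra_simps\<close>)
  have v6: "parallel (v 6) (vector [0, 1, - t - t * t])"
    by (rule join_step_parallel[OF v _ v4 v5 v2 v7])
      (use steps  in \<open>auto simp: bracket_def vec_eq_iff forall_3 algebra_simps\<close>)
  have ce: "bracket (v 3) (v 6) (v 8) = 0" by (rule conc, code_simp, simp, simp)
  then have e: "t * (t * t) = t * (t + 1)"
    unfolding parallel_bracket[OF v3 v6 v8] by (simp add: bracket_def algebra_simps)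
  then have "golden t" using t0 by (simp add: golden_def)
  moreover have "parallel (v 8) (gvec t ((0, 1), (1, 0), (0, 0)))" using v8 by (simp)
  ultimately show ?thesis by blast
qed

section \<open>The golden equation for the second combinatorics\<close>

lemma steps_6: "closure_steps (combinatorics 6) {5, 3, 2, 10, 9} [(2, 3, 5, 10, 1), (2, 5, 3, 10, 7), (1, 7, 9, 10, 4), (4, 5, 1, 9, 6), (2, 4, 3, 6, 8)]"
  by code_simp

text \<open>Here {3,5,9} makes the third coordinate of the free line vanish, and {7,8,9} is the only
  block not consumed by the joins.\<close>

lemma golden_6:
  assumes v: "realizes_vec (combinatorics 6) v" and frame: "v 5 = vector [1, 0, 0]" "v 3 = vector [0, 1, 0]"
    "v 2 = vector [0, 0, 1]" "v 10 = vector [1, 1, 1]"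
  shows "\<exists>t. golden t \<and> parallel (v 9) (gvec t ((0, 1), (1, 0), (0, 0)))"
proof -
  note steps = steps_6[unfolded closure_steps.simps]
  have conc: "bracket (v i) (v j) (v k) = 0" if "concurrent_triple (combinatorics 6) i j k"
      "{i, j, k} \<subseteq> {1..10}" "distinct [i, j, k]" for i j k
    using realizes_vec_bracket[OF v that(2,3)] that(1) by blast
  have nconc: "bracket (v i) (v j) (v k) \<noteq> 0" if "\<not> concurrent_triple (combinatorics 6) i j k"
      "{i, j, k} \<subseteq> {1..10}" "distinct [i, j, k]" for i j k
    using realizes_vec_bracket[OF v that(2,3)] that(1) by blast
  obtain x y z where xyz: "v 9 = vector [x, y, z]"
    using that[of "v 9 $ 1" "v 9 $ 2" "v 9 $ 3"] by (simp add: vec_eq_iff forall_3)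
  have ny: "bracket (v 5) (v 2) (v 9) \<noteq> 0" by (rule nconc, code_simp, simp, simp)
  then have y: "y \<noteq> 0" unfolding frame xyz by (simp add: bracket_def)
  have cz: "bracket (v 5) (v 3) (v 9) = 0" by (rule conc, code_simp, simp, simp)
  then have z: "z = 0" unfolding frame xyz by (simp add: bracket_def)
  define t where "t = x / y"
  have v9: "parallel (v 9) (vector [t, 1, 0])"
    unfolding parallel_def xyz using y by (intro exI[of _ y]) (simp add: vec_eq_iff forall_3 t_def z)
  have v5: "parallel (v 5) (vector [1, 0, 0])"
    and v3: "parallel (v 3) (vector [0, 1, 0])"
    and v2: "parallel (v 2) (vector [0, 0, 1])"
    and v10: "parallel (v 10) (vector [1, 1, 1])"
    unfolding frame by (rule parallel_refl)+
  have v1: "parallel (v 1) (vector [0, 1, 1])"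
    by (rule join_step_parallel[OF v _ v2 v3 v5 v10])
      (use steps  in \<open>auto simp: bracket_def vec_eq_iff forall_3 algebra_simps\<close>)
  have v7: "parallel (v 7) (vector [1, 0, 1])"
    by (rule join_step_parallel[OF v _ v2 v5 v3 v10])
      (use steps  in \<open>auto simp: bracket_def vec_eq_iff forall_3 algebra_simps\<close>)
  have v4: "parallel (v 4) (vector [1, t, t + 1])"
    by (rule join_step_parallel[OF v _ v1 v7 v9 v10])
      (use steps  in \<open>auto simp: bracket_def vec_eq_iff forall_3 algebra_simps\<close>)
  have v6: "parallel (v 6) (vector [- t, t, t + 1])"
    by (rule join_step_parallel[OF v _ v4 v5 v1 v9])
      (use steps  in \<open>auto simp: bracket_def vec_eq_iff forall_3 algebra_simps\<close>)
  have v8: "parallel (v 8) (vector [t, t * t, - t - 1])"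
    by (rule join_step_parallel[OF v _ v2 v4 v3 v6])
      (use steps  in \<open>auto simp: bracket_def vec_eq_iff forall_3 algebra_simps\<close>)
  have nt1: "bracket (v 2) (v 8) (v 9) \<noteq> 0" by (rule nconc, code_simp, simp, simp)
  then have t1: "t * t \<noteq> 1"
    unfolding parallel_bracket[OF v2 v8 v9] by (simp add: bracket_def algebra_simps)
  have t2: "t + 1 \<noteq> 0"
  proof
    assume "t + 1 = 0"
    then have "t = - 1" by (simp add: eq_neg_iff_add_eq_0)
    then show False using t1 by simp
  qed
  have ce: "bracket (v 7) (v 8) (v 9) = 0" by (rule conc, code_simp, simp, simp)
  then have e: "(t + 1) * (t * t) = (t + 1) * (t + 1)"
    unfolding parallel_bracket[OF v7 v8 v9] by (simp add: bracket_def algebra_simps)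
  then have "golden t" using t2 unfolding golden_def by simp
  moreover have "parallel (v 9) (gvec t ((0, 1), (1, 0), (0, 0)))" using v9 by (simp)
  ultimately show ?thesis by blast
qed

section \<open>The golden equation for the third combinatorics\<close>

lemma steps_7: "closure_steps (combinatorics 7) {2, 4, 1, 6, 10} [(1, 2, 4, 10, 3), (1, 4, 6, 10, 7), (2, 4, 3, 6, 8), (1, 6, 2, 10, 9), (4, 6, 2, 7, 5)]"
  by code_simp

lemma golden_7:
  assumes v: "realizes_vec (combinatorics 7) v" and frame: "v 2 = vector [1, 0, 0]" "v 4 = vector [0, 1, 0]"
    "v 1 = vector [0, 0, 1]" "v 6 = vector [1, 1, 1]"
  shows "\<exists>t. golden t \<and> parallel (v 10) (gvec t ((0, 1), (1, 0), (1, 1)))"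
proof -
  note steps = steps_7[unfolded closure_steps.simps]
  have conc: "bracket (v i) (v j) (v k) = 0" if "concurrent_triple (combinatorics 7) i j k"
      "{i, j, k} \<subseteq> {1..10}" "distinct [i, j, k]" for i j k
    using realizes_vec_bracket[OF v that(2,3)] that(1) by blast
  have nconc: "bracket (v i) (v j) (v k) \<noteq> 0" if "\<not> concurrent_triple (combinatorics 7) i j k"
      "{i, j, k} \<subseteq> {1..10}" "distinct [i, j, k]" for i j k
    using realizes_vec_bracket[OF v that(2,3)] that(1) by blast
  obtain x y z where xyz: "v 10 = vector [x, y, z]"
    using that[of "v 10 $ 1" "v 10 $ 2" "v 10 $ 3"] by (simp add: vec_eq_iff forall_3)
  have ny: "bracket (v 2) (v 1) (v 10) \<noteq> 0" by (rule nconc, code_simp, simp, simp)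
  then have y: "y \<noteq> 0" unfolding frame xyz by (simp add: bracket_def)
  define t where "t = x / y"
  define s where "s = z / y"
  have v10: "parallel (v 10) (vector [t, 1, s])"
    unfolding parallel_def xyz using y by (intro exI[of _ y]) (simp add: vec_eq_iff forall_3 t_def s_def)
  have v2: "parallel (v 2) (vector [1, 0, 0])"
    and v4: "parallel (v 4) (vector [0, 1, 0])"
    and v1: "parallel (v 1) (vector [0, 0, 1])"
    and v6: "parallel (v 6) (vector [1, 1, 1])"
    unfolding frame by (rule parallel_refl)+
  \<comment> \<open>The three nonconcurrencies keep the joined vectors nonzero and allow the factors
    s - t and \<open>s\<close> to be cancelled at the end.\<close>
  have nt0: "bracket (v 4) (v 1) (v 10) \<noteq> 0" by (rule nconc, code_simp, simp, simp)
  then have t0: "t \<noteq> 0"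
    unfolding parallel_bracket[OF v4 v1 v10] by (simp add: bracket_def)
  have nt1: "bracket (v 1) (v 6) (v 10) \<noteq> 0" by (rule nconc, code_simp, simp, simp)
  then have t1: "t \<noteq> 1"
    unfolding parallel_bracket[OF v1 v6 v10] by (simp add: bracket_def)
  have nst: "bracket (v 4) (v 6) (v 10) \<noteq> 0" by (rule nconc, code_simp, simp, simp)
  then have st: "s \<noteq> t"
    unfolding parallel_bracket[OF v4 v6 v10] by (simp add: bracket_def)
  have v3: "parallel (v 3) (vector [t, 0, s])"
    by (rule join_step_parallel[OF v _ v1 v2 v4 v10])
      (use steps t0 in \<open>auto simp: bracket_def vec_eq_iff forall_3 algebra_simps\<close>)
  have v7: "parallel (v 7) (vector [0, t - 1, t - s])"
    by (rule join_step_parallel[OF v _ v1 v4 v6 v10])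
      (use steps t1 in \<open>auto simp: bracket_def vec_eq_iff forall_3 algebra_simps\<close>)
  have v8: "parallel (v 8) (vector [s - t, s, 0])"
    by (rule join_step_parallel[OF v _ v2 v4 v3 v6])
      (use steps st in \<open>auto simp: bracket_def vec_eq_iff forall_3 algebra_simps\<close>)
  have v9: "parallel (v 9) (vector [1, 1, s])"
    by (rule join_step_parallel[OF v _ v1 v6 v2 v10])
      (use steps  in \<open>auto simp: bracket_def vec_eq_iff forall_3 algebra_simps\<close>)
  have v5: "parallel (v 5) (vector [t - s, t - 1, t - s])"
    by (rule join_step_parallel[OF v _ v4 v6 v2 v7])
      (use steps t1 in \<open>auto simp: bracket_def vec_eq_iff forall_3 algebra_simps\<close>)
  have ce: "bracket (v 7) (v 8) (v 9) = 0" by (rule conc, code_simp, simp, simp)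
  then have e: "(s - t) * (s * (t - 1)) = (s - t) * t"
    unfolding parallel_bracket[OF v7 v8 v9] by (simp add: bracket_def algebra_simps)
  then have e1: "s * (t - 1) = t" using st by simp
  then have s0: "s \<noteq> 0" using t0 by auto
  have cf: "bracket (v 3) (v 5) (v 9) = 0" by (rule conc, code_simp, simp, simp)
  then have f: "t * (s * (t - 1) - t + s) + s * (1 - s) = 0"
    unfolding parallel_bracket[OF v3 v5 v9] by (simp add: bracket_def algebra_simps)
  have "s * s = s * (t + 1)" using f unfolding e1 by (simp add: algebra_simps)
  then have s: "s = t + 1" using s0 by simp
  have "golden t" using e1 unfolding s golden_def by (simp add: algebra_simps)
  moreover have "parallel (v 10) (gvec t ((0, 1), (1, 0), (1, 1)))" using v10 by (simp add: s add.commute)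
  ultimately show ?thesis by blast
qed

section \<open>The certificates for the three cases\<close>

lemma golden_combinatorics_1: "\<exists>N \<tau>. golden_combinatorics (combinatorics 1) 1 5 4 9 8 N \<tau>"
  unfolding combinatorics_1
\<comment> \<open>The witnesses remain schematic until the checks below supply the coordinates and
  the permutation.\<close>
proof (intro exI, rule golden_combinatoricsI)
  show "certifies_brackets blocks1 coords1" by code_simp
  show "certifies_combinatorics blocks1" by code_simp
  \<comment> \<open>The involution (1 6)(2 5)(3 4)(7 8), which exchanges the two quadruple
    points.\<close>
  show "certifies_symmetry blocks1 [6, 5, 4, 3, 2, 1, 8, 7, 9, 10]" by code_simp
  show "let V = \<lambda>j. coords1 ! ([6, 5, 4, 3, 2, 1, 8, 7, 9, 10] ! (j - 1) - 1) in
      gmul (gbracket (V 8) (V 5) (V 4)) (gbracket (V 1) (V 9) (V 4)) =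
      gmul (1, - 1) (gmul (gbracket (V 1) (V 8) (V 4)) (gbracket (V 9) (V 5) (V 4)))"
    by code_simp
  show "\<not> concurrent_triple (block_sets blocks1) 1 5 4"
    "\<not> concurrent_triple (block_sets blocks1) 1 5 9"
    "\<not> concurrent_triple (block_sets blocks1) 1 4 9"
    "\<not> concurrent_triple (block_sets blocks1) 5 4 9"
    "\<not> concurrent_triple (block_sets blocks1) 1 8 4"
    unfolding concurrent_triple_block_sets by code_simp+
qed (rule steps_1[unfolded combinatorics_1], simp, simp, simp add: coords1_def,
    simp add: coords1_def, simp add: coords1_def, simp add: coords1_def,
    simp add: coords1_def, rule golden_1[unfolded combinatorics_1])

lemma golden_combinatorics_6: "\<exists>N \<tau>. golden_combinatorics (combinatorics 6) 5 3 2 10 9 N \<tau>"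
  unfolding combinatorics_6
proof (intro exI, rule golden_combinatoricsI)
  show "certifies_brackets blocks6 coords6" by code_simp
  show "certifies_combinatorics blocks6" by code_simp
  show "certifies_symmetry blocks6 [5, 6, 4, 3, 1, 2, 9, 8, 7, 10]" by code_simp
  show "let V = \<lambda>j. coords6 ! ([5, 6, 4, 3, 1, 2, 9, 8, 7, 10] ! (j - 1) - 1) in
      gmul (gbracket (V 9) (V 3) (V 2)) (gbracket (V 5) (V 10) (V 2)) =
      gmul (1, - 1) (gmul (gbracket (V 5) (V 9) (V 2)) (gbracket (V 10) (V 3) (V 2)))"
    by code_simp
  show "\<not> concurrent_triple (block_sets blocks6) 5 3 2"
    "\<not> concurrent_triple (block_sets blocks6) 5 3 10"
    "\<not> concurrent_triple (block_sets blocks6) 5 2 10"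
    "\<not> concurrent_triple (block_sets blocks6) 3 2 10"
    "\<not> concurrent_triple (block_sets blocks6) 5 9 2"
    unfolding concurrent_triple_block_sets by code_simp+
qed (rule steps_6[unfolded combinatorics_6], simp, simp, simp add: coords6_def,
    simp add: coords6_def, simp add: coords6_def, simp add: coords6_def,
    simp add: coords6_def, rule golden_6[unfolded combinatorics_6])

lemma golden_combinatorics_7: "\<exists>N \<tau>. golden_combinatorics (combinatorics 7) 2 4 1 6 10 N \<tau>"
  unfolding combinatorics_7
proof (intro exI, rule golden_combinatoricsI)
  show "certifies_brackets blocks7 coords7" by code_simp
  show "certifies_combinatorics blocks7" by code_simp
  show "certifies_symmetry blocks7 [1, 3, 2, 9, 8, 7, 6, 5, 4, 10]" by code_simp
  show "let V = \<lambda>j. coords7 ! ([1, 3, 2, 9, 8, 7, 6, 5, 4, 10] ! (j - 1) - 1) in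
      gmul (gbracket (V 10) (V 4) (V 1)) (gbracket (V 2) (V 6) (V 1)) =
      gmul (1, - 1) (gmul (gbracket (V 2) (V 10) (V 1)) (gbracket (V 6) (V 4) (V 1)))"
    by code_simp
  show "\<not> concurrent_triple (block_sets blocks7) 2 4 1"
    "\<not> concurrent_triple (block_sets blocks7) 2 4 6"
    "\<not> concurrent_triple (block_sets blocks7) 2 1 6"
    "\<not> concurrent_triple (block_sets blocks7) 4 1 6"
    "\<not> concurrent_triple (block_sets blocks7) 2 10 1"
    unfolding concurrent_triple_block_sets by code_simp+
qed (rule steps_7[unfolded combinatorics_7], simp, simp, simp add: coords7_def,
    simp add: coords7_def, simp add: coords7_def, simp add: coords7_def,
    simp add: coords7_def, rule golden_7[unfolded combinatorics_7])

theorem theorem2p6: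
  fixes i :: nat
  assumes "i \<in> {1, 6, 7}"
  shows "(\<exists>A. arrangement 10 A \<and> has_combinatorics 10 (combinatorics i) A) \<and>
    (\<forall>A. arrangement 10 A \<and> has_combinatorics 10 (combinatorics i) A \<longrightarrow>
      (\<exists>H. subgroup H (Aut 10 A) \<and> (Aut 10 A)\<lparr>carrier := H\<rparr> \<cong> integer_mod_group 2) \<and>
      card (connected_components_of (moduli_space 10 A)) = 2 \<and>
      (\<exists>Cp Cm Ap Am.
         connected_components_of (moduli_space 10 A) = {Cp, Cm} \<and> Cp \<noteq> Cm \<and>
         Ap \<in> realizations 10 A \<and> PGL_orbit 10 Ap \<in> Cp \<and>
         Am \<in> realizations 10 A \<and> PGL_orbit 10 Am \<in> Cm \<and>
         (\<exists>\<psi>. homeomorphism (complement 10 Ap) (complement 10 Am) swap_xy \<psi>)))"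
proof -
  have "\<exists>a b c d l N \<tau>. golden_combinatorics (combinatorics i) a b c d l N \<tau>"
    using assms golden_combinatorics_1 golden_combinatorics_6 golden_combinatorics_7 by blast
  then obtain a b c d l N \<tau> where "golden_combinatorics (combinatorics i) a b c d l N \<tau>" by blast
  then interpret golden_combinatorics "combinatorics i" a b c d l N \<tau> .
  show ?thesis
  proof (intro conjI existence allI impI)
    fix A assume "arrangement 10 A \<and> has_combinatorics 10 (combinatorics i) A"
    then have A: "realizes 10 (combinatorics i) A" by (blast intro: has_combinatorics_imp_realizes)
    show "\<exists>H. subgroup H (Aut 10 A) \<and> (Aut 10 A)\<lparr>carrier := H\<rparr> \<cong> integer_mod_group 2"
      by (rule automorphism[OF A])
    show "card (connected_components_of (moduli_space 10 A)) = 2"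
      by (rule components(1)[OF A])
    show "\<exists>Cp Cm Ap Am.
         connected_components_of (moduli_space 10 A) = {Cp, Cm} \<and> Cp \<noteq> Cm \<and>
         Ap \<in> realizations 10 A \<and> PGL_orbit 10 Ap \<in> Cp \<and>
         Am \<in> realizations 10 A \<and> PGL_orbit 10 Am \<in> Cm \<and>
         (\<exists>\<psi>. homeomorphism (complement 10 Ap) (complement 10 Am) swap_xy \<psi>)"
      by (rule components(2)[OF A])
  qed
qed

end
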